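(* In the setting described in the context, assume that $\delta_{\boldsymbol{a}_k}\in(0,1)$ for all $k\in\mathbb{N}$. Then the following statements hold. a) If $\Phi^{\flat\flat}_k:\mathcal{K}^d\to\mathbb{R}$ is lower semicontinuous for all $k$ and $\lim_{k\to\infty}\sup_{K\in\mathcal{M}^{\flat\flat}_k}|\Phi(K)-\Phi^{\flat\flat}_k(K)|=0$, then $\operatorname{argmin}_{K\in\mathcal{M}}\Phi(K)\ne\emptyset$ and \[\lim_{k\to\infty}\mathcal{D}\big(\operatorname{argmin}_{K\in\mathcal{M}^{\flat\flat}_k}\Phi^{\flat\flat}_k(K),\ \operatorname{argmin}_{K\in\mathcal{M}}\Phi(K)\big)=0.\] b) If $\Phi^{\flat}_k:\mathcal{K}^d\to\mathbb{R}$ is lower semicontinuous for all $k$ and $\lim_{k\to\infty}\sup_{K\in\mathcal{M}^{\flat}_k}|\Phi(K)-\Phi^{\flat}_k(K)|=0$, then $\operatorname{argmin}_{K\in\mathcal{M}}\Phi(K)\ne\emptyset$ and \[\lim_{k\to\infty}\mathcal{D}\big(\operatorname{argmin}_{K\in\mathcal{M}^{\flat}_k}\Phi^{\flat}_k(K),\ \operatorname{argmin}_{K\in\mathcal{M}}\Phi(K)\big)=0.\] c) If $\Phi^{\flat\sharp}_k:\mathcal{K}^d\to\mathbb{R}$ is lower semicontinuous for all $k$ and $\lim_{k\to\infty}\sup_{K\in\mathcal{M}^{\flat\sharp}_k}|\Phi(K)-\Phi^{\flat\sharp}_k(K)|=0$, then $\operatorname{argmin}_{K\in\mathcal{M}}\Phi(K)\ne\emptyset$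 and \[\lim_{k\to\infty}\mathcal{D}\big(\operatorname{argmin}_{K\in\mathcal{M}^{\flat\sharp}_k}\Phi^{\flat\sharp}_k(K),\ \operatorname{argmin}_{K\in\mathcal{M}}\Phi(K)\big)=0.\]
   Context: Let $d\ge 2$. $\mathcal{K}^d$ is the space of all nonempty, convex and compact subsets of $\mathbb{R}^d$, equipped with the Hausdorff distance $\operatorname{dist}_H$ (Euclidean norm); $\|K\|:=\max_{x\in K}\|x\|$. Semicontinuity and continuity on $\mathcal{K}^d$ are with respect to $\operatorname{dist}_H$. For nonempty bounded collections $\mathcal{A},\mathcal{A}'\subset\mathcal{K}^d$ let $\mathcal{D}(\mathcal{A},\mathcal{A}'):=\sup_{K\in\mathcal{A}}\inf_{K'\in\mathcal{A}'}\operatorname{dist}_H(K,K')$. For a tuple $\boldsymbol{a}=(a_1,\ldots,a_N)\in\mathbb{R}^{d\times N}$ of pairwise distinct Euclidean unit vectors define - $\mathcal{C}^\flat_{\boldsymbol{a}}:=\{\boldsymbol{x}=(x_1,\ldots,x_N)\in\mathbb{R}^{d\times N}: a_i^Tx_j\le a_i^Tx_i\ \text{for all}\ i\ne j\}$ and $\mathcal{P}^\flat_{\boldsymbol{a}}:=\{\operatorname{conv}\{x_1,\ldots,x_N\}:\boldsymbol{x}\in\mathcal{C}^\flat_{\boldsymbol{a}}\}$; - $\Pi^\flat_{\boldsymbol{a}}(K):=\{\operatorname{conv}\{x_1,\ldots,x_N\}: x_i\in\operatorname{argmax}_{x\in K}a_i^Tx\ \text{for all}\ i\}$ for $K\in\mathcal{K}^d$;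 - $\Pi^\sharp_{\boldsymbol{a}}(K):=\{x\in\mathbb{R}^d: a_i^Tx\le\max_{y\in K}a_i^Ty\ \text{for all}\ i\}$ for $K\in\mathcal{K}^d$; - $\delta_{\boldsymbol{a}}:=\max_{u\in S^{d-1}}\min_{i}\|u-a_i\|$. Nested Galerkin sequence: $(N_k)_k$ is a strictly increasing sequence of positive integers, each $\boldsymbol{a}_k\in\mathbb{R}^{d\times N_k}$ has pairwise distinct unit-norm columns $[\boldsymbol{a}_k]_1,\ldots,[\boldsymbol{a}_k]_{N_k}$, $\lim_{k\to\infty}\delta_{\boldsymbol{a}_k}=0$ (Galerkin), and $[\boldsymbol{a}_k]_i=[\boldsymbol{a}_\ell]_i$ for all $k\le\ell$ and $i\in\{1,\ldots,N_k\}$ (nested). Setting. Let $\Phi:(\mathcal{K}^d,\operatorname{dist}_H)\to\mathbb{R}$ be continuous, let $\Psi:(\mathcal{K}^d,\operatorname{dist}_H)\to(\mathbb{R}^m,\|\cdot\|_\infty)$ be Lipschitz on bounded subcollections of $\mathcal{K}^d$, let $\hat K\in\mathcal{K}^d$, and assume that \[\mathcal{M}:=\{K\in\mathcal{K}^d:\Psi(K)\le 0,\ K\subset\hat K\}\ne\emptyset\] (inequalities between vectors are componentwise). Let $(\boldsymbol{a}_k)_k$ be a nested Galerkin sequence, and let $\hat P_k\in\Pi^\flat_{\boldsymbol{a}_k}(\hat K)$ for all $k$. Let $\ell>0$ be such that $\Psi$ is $\ell$-Lipschitz on the union of $\mathcal{M}$ with \[\bigcup_{k}\big(\{P\in\mathcal{P}^\flat_{\boldsymbol{a}_k}:P\subset\hat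 P_k\}\cup\{P\in\mathcal{P}^\flat_{\boldsymbol{a}_k}:P\subset\hat K\}\cup\{P\in\mathcal{P}^\flat_{\boldsymbol{a}_k}:P\subset\Pi^\sharp_{\boldsymbol{a}_k}(\hat K)\}\big)\] (such $\ell$ exists when $\delta_{\boldsymbol{a}_k}\in(0,1)$ for all $k$). With $\mathbb{1}\in\mathbb{R}^m$ the vector of ones, define \[\Psi^{\flat\flat}_k(P):=\Psi(P)-4\ell\delta_{\boldsymbol{a}_k}\|\hat K\|\mathbb{1},\quad \Psi^{\flat}_k(P):=\Psi(P)-2\ell\delta_{\boldsymbol{a}_k}\|\hat K\|\mathbb{1},\quad \Psi^{\flat\sharp}_k(P):=\Psi(P)-2\ell\delta_{\boldsymbol{a}_k}\|\hat K\|\mathbb{1},\] \[\mathcal{M}^{\flat\flat}_k:=\{P\in\mathcal{P}^\flat_{\boldsymbol{a}_k}:\Psi^{\flat\flat}_k(P)\le0,\ P\subset\hat P_k\},\quad \mathcal{M}^{\flat}_k:=\{P\in\mathcal{P}^\flat_{\boldsymbol{a}_k}:\Psi^{\flat}_k(P)\le0,\ P\subset\hat K\},\] \[\mathcal{M}^{\flat\sharp}_k:=\{P\in\mathcal{P}^\flat_{\boldsymbol{a}_k}:\Psi^{\flat\sharp}_k(P)\le0,\ P\subset\Pi^\sharp_{\boldsymbol{a}_k}(\hat K)\}.\] *)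

theory Defs
  imports "HOL-Analysis.Analysis"
begin

section \<open>The metric space of convex bodies\<close>

definition convex_bodies :: "(real ^ 'd) set set" where
  "convex_bodies = {K. K \<noteq> {} \<and> convex K \<and> compact K}"

text \<open>The value outside \<open>convex_bodies\<close> is irrelevant; it is set to 0 because the locale
  \<open>Metric_space\<close> demands nonnegativity and symmetry on the whole type.\<close>

definition hausdorff_dist :: "(real ^ 'd) set \<Rightarrow> (real ^ 'd) set \<Rightarrow> real" where
  "hausdorff_dist A B =
     (if A \<in> convex_bodies \<and> B \<in> convex_bodies
      then max (SUP x\<in>A. infdist x B) (SUP y\<in>B. infdist y A) else 0)"

lemma bdd_above_infdist:
  fixes A B :: "(real ^ 'd) set"
  assumes "compact A"
  shows "bdd_above ((\<lambda>x. infdist x B) ` A)"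
  by (intro bounded_imp_bdd_above compact_imp_bounded compact_continuous_image
      continuous_on_infdist continuous_on_id assms)

lemma infdist_le_hausdorff_dist:
  assumes "A \<in> convex_bodies" "B \<in> convex_bodies"
  shows "x \<in> A \<Longrightarrow> infdist x B \<le> hausdorff_dist A B"
    and "y \<in> B \<Longrightarrow> infdist y A \<le> hausdorff_dist A B"
proof -
  have c: "compact A" "compact B"
    using assms by (auto simp: convex_bodies_def)
  show "infdist x B \<le> hausdorff_dist A B" if "x \<in> A"
    using cSUP_upper[OF that bdd_above_infdist[OF c(1), of B]] assms
    by (simp add: hausdorff_dist_def le_max_iff_disj)
  show "infdist y A \<le> hausdorff_dist A B" if "y \<in> B"
    using cSUP_upper[OF that bdd_above_infdist[OF c(2), of A]] assms
    by (simp add: hausdorff_dist_def le_max_iff_disj)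
qed

lemma hausdorff_dist_le:
  assumes "A \<in> convex_bodies" "B \<in> convex_bodies"
    and "\<And>x. x \<in> A \<Longrightarrow> infdist x B \<le> r" and "\<And>y. y \<in> B \<Longrightarrow> infdist y A \<le> r"
  shows "hausdorff_dist A B \<le> r"
  using assms by (auto simp: hausdorff_dist_def convex_bodies_def intro!: cSUP_least)

lemma hausdorff_dist_nonneg: "0 \<le> hausdorff_dist A B"
proof (cases "A \<in> convex_bodies \<and> B \<in> convex_bodies")
  case True
  then obtain x where "x \<in> A"
    by (auto simp: convex_bodies_def)
  then show ?thesis
    using infdist_le_hausdorff_dist(1)[of A B x] True infdist_nonneg[of x B] by linarith
qed (auto simp: hausdorff_dist_def)

lemma infdist_triangle_hausdorff_dist:
  assumes "A \<in> convex_bodies" "B \<in> convex_bodies" "C \<in> convex_bodies" and "x \<in> A"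
  shows "infdist x C \<le> hausdorff_dist A B + hausdorff_dist B C"
proof -
  have B: "closed B" "B \<noteq> {}"
    using assms by (auto simp: convex_bodies_def compact_imp_closed)
  then obtain y where y: "y \<in> B" "infdist x B = dist x y"
    using infdist_attains_inf by blast
  have "infdist x C \<le> infdist y C + dist x y"
    by (rule infdist_triangle)
  then show ?thesis
    using infdist_le_hausdorff_dist(1)[OF assms(1,2,4)] infdist_le_hausdorff_dist(1)[OF assms(2,3) y(1)] y(2)
    by linarith
qed

lemma hausdorff_dist_commute: "hausdorff_dist A B = hausdorff_dist B A"
  by (auto simp: hausdorff_dist_def max.commute)

global_interpretation convex_bodies: Metric_space convex_bodies hausdorff_dist
proof
  fix A B C :: "(real ^ 'd) set"
  show "0 \<le> hausdorff_dist A B"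
    by (rule hausdorff_dist_nonneg)
  show "hausdorff_dist A B = hausdorff_dist B A"
    by (rule hausdorff_dist_commute)
  assume A: "A \<in> convex_bodies" and B: "B \<in> convex_bodies"
  have sub: "X \<subseteq> Y" if "X \<in> convex_bodies" "Y \<in> convex_bodies" "hausdorff_dist X Y = 0"
    for X Y :: "(real ^ 'd) set"
  proof
    fix x assume "x \<in> X"
    then have "infdist x Y = 0"
      using infdist_le_hausdorff_dist(1)[OF that(1,2)] that(3) infdist_nonneg[of x Y] by fastforce
    moreover have "closed Y" "Y \<noteq> {}"
      using that by (auto simp: convex_bodies_def compact_imp_closed)
    ultimately show "x \<in> Y"
      using in_closed_iff_infdist_zero by blast
  qed
  show "hausdorff_dist A B = 0 \<longleftrightarrow> A = B"
  proof
    assume "hausdorff_dist A B = 0"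
    then show "A = B"
      using sub[OF A B] sub[OF B A] hausdorff_dist_commute[of A B] by auto
  next
    assume "A = B"
    then have "hausdorff_dist A B \<le> 0"
      using A by (intro hausdorff_dist_le) auto
    then show "hausdorff_dist A B = 0"
      using hausdorff_dist_nonneg[of A B] by linarith
  qed
  assume C: "C \<in> convex_bodies"
  show "hausdorff_dist A C \<le> hausdorff_dist A B + hausdorff_dist B C"
    using infdist_triangle_hausdorff_dist[OF A B C] infdist_triangle_hausdorff_dist[OF C B A]
    by (intro hausdorff_dist_le A C)
      (auto simp: hausdorff_dist_commute[of C B] hausdorff_dist_commute[of B A] add.commute)
qed

abbreviation hausdorff_topology :: "(real ^ 'd) set topology" where
  "hausdorff_topology \<equiv> convex_bodies.mtopology"

definition body_norm :: "(real ^ 'd) set \<Rightarrow> real" where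
  "body_norm K = (SUP x\<in>K. norm x)"

definition lower_semicontinuous_map :: "'a topology \<Rightarrow> ('a \<Rightarrow> real) \<Rightarrow> bool" where
  "lower_semicontinuous_map X f \<longleftrightarrow>
     (\<forall>x\<in>topspace X. \<forall>c<f x. \<exists>U. openin X U \<and> x \<in> U \<and> (\<forall>y\<in>U. c < f y))"

definition lipschitz_on_bodies ::
    "real \<Rightarrow> ((real ^ 'd) set \<Rightarrow> real ^ 'm) \<Rightarrow> (real ^ 'd) set set \<Rightarrow> bool" where
  "lipschitz_on_bodies L \<Psi> \<A> \<longleftrightarrow>
     (\<forall>K\<in>\<A>. \<forall>K'\<in>\<A>. infnorm (\<Psi> K - \<Psi> K') \<le> L * hausdorff_dist K K')"

text \<open>Extended reals: an empty first argument gives \<open>-\<infinity>\<close>, an empty second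
  one (with nonempty first) gives \<open>\<infinity>\<close>, so neither can pass for a small excess.\<close>

definition hausdorff_excess :: "(real ^ 'd) set set \<Rightarrow> (real ^ 'd) set set \<Rightarrow> ereal" where
  "hausdorff_excess \<A> \<A>' = (SUP K\<in>\<A>. INF K'\<in>\<A>'. ereal (hausdorff_dist K K'))"

definition argmin_on :: "('a \<Rightarrow> real) \<Rightarrow> 'a set \<Rightarrow> 'a set" where
  "argmin_on f S = {x. is_arg_min f (\<lambda>x. x \<in> S) x}"

definition argmax_on :: "('a \<Rightarrow> real) \<Rightarrow> 'a set \<Rightarrow> 'a set" where
  "argmax_on f S = {x. is_arg_max f (\<lambda>x. x \<in> S) x}"


section \<open>Polytopes with prescribed directions\<close>

text \<open>A tuple \<open>(a\<^sub>1, \<dots>, a\<^sub>N)\<close> of vectors is given by its length \<open>N\<close> and a function on \<open>nat\<close>,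
  of which only the values on \<open>{1..N}\<close> matter.\<close>

definition unit_directions :: "nat \<Rightarrow> (nat \<Rightarrow> real ^ 'd) \<Rightarrow> bool" where
  "unit_directions N a \<longleftrightarrow> inj_on a {1..N} \<and> (\<forall>i\<in>{1..N}. norm (a i) = 1)"

definition C_flat :: "nat \<Rightarrow> (nat \<Rightarrow> real ^ 'd) \<Rightarrow> (nat \<Rightarrow> real ^ 'd) set" where
  "C_flat N a = {x. \<forall>i\<in>{1..N}. \<forall>j\<in>{1..N}. i \<noteq> j \<longrightarrow> a i \<bullet> x j \<le> a i \<bullet> x i}"

definition P_flat :: "nat \<Rightarrow> (nat \<Rightarrow> real ^ 'd) \<Rightarrow> (real ^ 'd) set set" where
  "P_flat N a = {convex hull (x ` {1..N}) | x. x \<in> C_flat N a}"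

definition Pi_flat :: "nat \<Rightarrow> (nat \<Rightarrow> real ^ 'd) \<Rightarrow> (real ^ 'd) set \<Rightarrow> (real ^ 'd) set set" where
  "Pi_flat N a K =
     {convex hull (x ` {1..N}) | x. \<forall>i\<in>{1..N}. x i \<in> argmax_on (\<lambda>y. a i \<bullet> y) K}"

definition Pi_sharp :: "nat \<Rightarrow> (nat \<Rightarrow> real ^ 'd) \<Rightarrow> (real ^ 'd) set \<Rightarrow> (real ^ 'd) set" where
  "Pi_sharp N a K = {x. \<forall>i\<in>{1..N}. a i \<bullet> x \<le> (SUP y\<in>K. a i \<bullet> y)}"

definition mesh :: "nat \<Rightarrow> (nat \<Rightarrow> real ^ 'd) \<Rightarrow> real" where
  "mesh N a = (SUP u\<in>sphere 0 1. MIN i\<in>{1..N}. norm (u - a i))"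

definition nested_galerkin :: "(nat \<Rightarrow> nat) \<Rightarrow> (nat \<Rightarrow> nat \<Rightarrow> real ^ 'd) \<Rightarrow> bool" where
  "nested_galerkin N a \<longleftrightarrow>
     strict_mono N \<and> (\<forall>k. 0 < N k) \<and> (\<forall>k. unit_directions (N k) (a k)) \<and>
     (\<lambda>k. mesh (N k) (a k)) \<longlonglongrightarrow> 0 \<and>
     (\<forall>k l. k \<le> l \<longrightarrow> (\<forall>i\<in>{1..N k}. a k i = a l i))"


section \<open>Feasible sets\<close>

definition feasible ::
    "((real ^ 'd) set \<Rightarrow> real ^ 'm) \<Rightarrow> (real ^ 'd) set \<Rightarrow> (real ^ 'd) set set" where
  "feasible \<Psi> Khat = {K \<in> convex_bodies. \<Psi> K \<le> 0 \<and> K \<subseteq> Khat}"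

definition Psi_flat_flat ::
    "((real ^ 'd) set \<Rightarrow> real ^ 'm) \<Rightarrow> real \<Rightarrow> (real ^ 'd) set \<Rightarrow>
     nat \<Rightarrow> (nat \<Rightarrow> real ^ 'd) \<Rightarrow> (real ^ 'd) set \<Rightarrow> real ^ 'm" where
  "Psi_flat_flat \<Psi> l Khat N a P = \<Psi> P - (4 * l * mesh N a * body_norm Khat) *\<^sub>R vec 1"

definition Psi_flat ::
    "((real ^ 'd) set \<Rightarrow> real ^ 'm) \<Rightarrow> real \<Rightarrow> (real ^ 'd) set \<Rightarrow>
     nat \<Rightarrow> (nat \<Rightarrow> real ^ 'd) \<Rightarrow> (real ^ 'd) set \<Rightarrow> real ^ 'm" where
  "Psi_flat \<Psi> l Khat N a P = \<Psi> P - (2 * l * mesh N a * body_norm Khat) *\<^sub>R vec 1"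

definition Psi_flat_sharp ::
    "((real ^ 'd) set \<Rightarrow> real ^ 'm) \<Rightarrow> real \<Rightarrow> (real ^ 'd) set \<Rightarrow>
     nat \<Rightarrow> (nat \<Rightarrow> real ^ 'd) \<Rightarrow> (real ^ 'd) set \<Rightarrow> real ^ 'm" where
  "Psi_flat_sharp \<Psi> l Khat N a P = \<Psi> P - (2 * l * mesh N a * body_norm Khat) *\<^sub>R vec 1"

definition M_flat_flat ::
    "((real ^ 'd) set \<Rightarrow> real ^ 'm) \<Rightarrow> real \<Rightarrow> (real ^ 'd) set \<Rightarrow>
     nat \<Rightarrow> (nat \<Rightarrow> real ^ 'd) \<Rightarrow> (real ^ 'd) set \<Rightarrow> (real ^ 'd) set set" where
  "M_flat_flat \<Psi> l Khat N a Phat =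
     {P \<in> P_flat N a. Psi_flat_flat \<Psi> l Khat N a P \<le> 0 \<and> P \<subseteq> Phat}"

definition M_flat ::
    "((real ^ 'd) set \<Rightarrow> real ^ 'm) \<Rightarrow> real \<Rightarrow> (real ^ 'd) set \<Rightarrow>
     nat \<Rightarrow> (nat \<Rightarrow> real ^ 'd) \<Rightarrow> (real ^ 'd) set set" where
  "M_flat \<Psi> l Khat N a =
     {P \<in> P_flat N a. Psi_flat \<Psi> l Khat N a P \<le> 0 \<and> P \<subseteq> Khat}"

definition M_flat_sharp ::
    "((real ^ 'd) set \<Rightarrow> real ^ 'm) \<Rightarrow> real \<Rightarrow> (real ^ 'd) set \<Rightarrow>
     nat \<Rightarrow> (nat \<Rightarrow> real ^ 'd) \<Rightarrow> (real ^ 'd) set set" where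
  "M_flat_sharp \<Psi> l Khat N a =
     {P \<in> P_flat N a. Psi_flat_sharp \<Psi> l Khat N a P \<le> 0 \<and> P \<subseteq> Pi_sharp N a Khat}"

end

(* Blaschke's selection theorem (Arzela-Ascoli applied to the distance functions of the bodies) turns
   the minimisers of the approximate problems into convergent subsequences. Their limits are feasible
   because the enlarged constraints shrink back to the original ones, and optimal because every
   feasible L is a limit of feasible polytopes: for a body L in the ball of radius R, a polytope
   spanned by maximisers of the directions a_i over L has distance at most 2 * mesh * R from L, and the
   Lipschitz constant l converts this distance into the slack granted in the constraint. *)
theory Submission
  imports Defs "HOL-Complex_Analysis.Great_Picard"
begin

text \<open>The three families of problems differ only in the container imposed on the polytopes and
  in how closely a feasible body can be approximated from within it. One scheme with container
  \<open>D k\<close>, radius \<open>b k\<close> and slack \<open>l * b k\<close> therefore covers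
  them all. A feasible body lies in \<open>Khat\<close>, hence in \<open>Pi_sharp\<close>, and there
  its own polytope is a competitor. It may stick out of \<open>Phat k\<close>, so in that case
  another body has to be approximated in its place. Compactness enters twice. For fixed
  \<open>k\<close> the vertex tuples stay in a compact set, so limits are again polytopes with the
  same directions and minimisers exist. Along varying \<open>k\<close> the number of vertices grows,
  and only Blaschke selection provides limits. Uniform closeness of the objectives on the
  approximate feasible sets turns minimality for \<open>\<Phi>k k\<close> into minimality for
  \<open>\<Phi>\<close> up to a vanishing error.\<close>

section \<open>Distance functions of convex sets\<close>

lemma convex_on_infdist:
  fixes C :: "'a::euclidean_space set"
  assumes "convex C" "closed C" "C \<noteq> {}"
  shows "convex_on UNIV (\<lambda>x. infdist x C)"
proof (rule convex_onI)
  fix t :: real and x y :: 'a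
  assume t: "0 < t" "t < 1"
  obtain p where p: "p \<in> C" "infdist x C = dist x p"
    using infdist_attains_inf assms by blast
  obtain q where q: "q \<in> C" "infdist y C = dist y q"
    using infdist_attains_inf assms by blast
  have "(1 - t) *\<^sub>R p + t *\<^sub>R q \<in> C"
    using assms(1) p(1) q(1) t by (simp add: convexD)
  then have "infdist ((1 - t) *\<^sub>R x + t *\<^sub>R y) C
      \<le> dist ((1 - t) *\<^sub>R x + t *\<^sub>R y) ((1 - t) *\<^sub>R p + t *\<^sub>R q)"
    by (rule infdist_le)
  also have "\<dots> = norm ((1 - t) *\<^sub>R (x - p) + t *\<^sub>R (y - q))"
    by (simp add: dist_norm algebra_simps)
  also have "\<dots> \<le> norm ((1 - t) *\<^sub>R (x - p)) + norm (t *\<^sub>R (y - q))"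
    by (rule norm_triangle_ineq)
  also have "\<dots> = (1 - t) * infdist x C + t * infdist y C"
    using t by (simp add: p q dist_norm)
  finally show "infdist ((1 - t) *\<^sub>R x + t *\<^sub>R y) C \<le> (1 - t) * infdist x C + t * infdist y C" .
qed simp

text \<open>Because such parallel sets are convex, a distance bound checked at vertices extends to
  their hull, and the intersection with a polytope is again a convex body once it is
  nonempty.\<close>

lemma convex_infdist_le:
  fixes C :: "'a::euclidean_space set"
  assumes "convex C" "closed C" "C \<noteq> {}"
  shows "convex {x. infdist x C \<le> r}"
proof (rule convexI)
  fix x y :: 'a and u v :: real
  assume h: "x \<in> {x. infdist x C \<le> r}" "y \<in> {x. infdist x C \<le> r}" "0 \<le> u" "0 \<le> v" "u + v = 1"
  have "infdist (u *\<^sub>R x + v *\<^sub>R y) C \<le> u * infdist x C + v * infdist y C"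
    using convex_on_infdist[OF assms] h unfolding convex_on_def by blast
  also have "\<dots> \<le> u * r + v * r"
    using h by (intro add_mono mult_left_mono) auto
  also have "\<dots> = r"
    using h by (metis distrib_right mult_1)
  finally show "u *\<^sub>R x + v *\<^sub>R y \<in> {x. infdist x C \<le> r}"
    by simp
qed

text \<open>The relevant direction \<open>u\<close> is that from the nearest point of \<open>C\<close> to \<open>x\<close>.\<close>

lemma infdist_le_support:
  fixes C :: "'a::euclidean_space set"
  assumes C: "convex C" "closed C" "C \<noteq> {}" and r: "0 \<le> r"
    and h: "\<And>u. norm u = 1 \<Longrightarrow> \<exists>c\<in>C. u \<bullet> x \<le> u \<bullet> c + r"
  shows "infdist x C \<le> r"
proof -
  define p where "p = closest_point C x"
  have p: "p \<in> C"
    unfolding p_def by (rule closest_point_in_set[OF C(2,3)])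
  show ?thesis
  proof (cases "x = p")
    case True
    then show ?thesis using p r by simp
  next
    case False
    define u where "u = sgn (x - p)"
    have "norm u = 1"
      using False by (simp add: u_def norm_sgn)
    then obtain c where c: "c \<in> C" "u \<bullet> x \<le> u \<bullet> c + r"
      using h by blast
    have "(x - p) \<bullet> (c - p) \<le> 0"
      unfolding p_def by (rule closest_point_dot[OF C(1,2) c(1)])
    then have "u \<bullet> (c - p) \<le> 0"
      using False by (simp add: u_def sgn_div_norm mult_le_0_iff)
    moreover have "u \<bullet> (x - p) = norm (x - p)"
      using False by (simp add: u_def sgn_div_norm dot_square_norm power2_eq_square)
    ultimately have "dist x p \<le> r"
      using c(2) by (simp add: dist_norm inner_diff_right)
    then show ?thesis
      using infdist_le[OF p, of x] by linarith
  qed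
qed

section \<open>Mesh width and norm bounds\<close>

lemma ex_direction_near:
  assumes a: "unit_directions N a" and N: "0 < N" and u: "norm u = 1"
  obtains i where "i \<in> {1..N}" "norm (u - a i) \<le> mesh N a"
proof -
  have ne: "{1..N} \<noteq> {}" using N by simp
  let ?f = "\<lambda>v. MIN i\<in>{1..N}. norm (v - a i)"
  \<comment> \<open>A supremum of reals is an upper bound only for a family bounded above; two unit
    vectors are at most 2 apart.\<close>
  have "?f v \<le> 2" if "v \<in> sphere 0 1" for v
  proof -
    have "?f v \<le> norm (v - a 1)"
      using N by (intro Min_le) auto
    also have "\<dots> \<le> norm v + norm (a 1)"
      by (rule norm_triangle_ineq4)
    also have "\<dots> \<le> 2"
      using that a N by (auto simp: unit_directions_def)
    finally show ?thesis .
  qed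
  then have "bdd_above (?f ` sphere 0 1)"
    by (rule bdd_aboveI2)
  then have "?f u \<le> mesh N a"
    unfolding mesh_def using u by (intro cSUP_upper) auto
  moreover have "?f u \<in> (\<lambda>i. norm (u - a i)) ` {1..N}"
    using ne by (intro Min_in) auto
  ultimately show ?thesis
    using that by auto
qed

lemma mesh_nonneg:
  fixes a :: "nat \<Rightarrow> real ^ 'd"
  assumes "unit_directions N a" "0 < N"
  shows "0 \<le> mesh N a"
proof -
  \<comment> \<open>Any unit vector serves; a coordinate vector with arbitrary index exists in every
    dimension.\<close>
  have "norm (axis undefined 1 :: real ^ 'd) = 1"
    by simp
  then obtain i where "norm (axis undefined 1 - a i) \<le> mesh N a"
    using ex_direction_near[OF assms] by metis
  then show ?thesis
    using norm_ge_zero[of "axis undefined 1 - a i"] by linarith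
qed

lemma norm_le_body_norm:
  assumes "K \<in> convex_bodies" "x \<in> K"
  shows "norm x \<le> body_norm K"
  unfolding body_norm_def
  using assms
  by (intro cSUP_upper bounded_imp_bdd_above compact_imp_bounded compact_continuous_image)
    (auto simp: convex_bodies_def intro: continuous_intros)

lemma body_norm_nonneg:
  assumes "K \<in> convex_bodies"
  shows "0 \<le> body_norm K"
proof -
  obtain x where "x \<in> K" using assms by (auto simp: convex_bodies_def)
  then show ?thesis
    using norm_le_body_norm[OF assms] norm_ge_zero order_trans by blast
qed

lemma convex_bodies_Int_nonempty:
  assumes "K \<in> convex_bodies" "convex D" "closed D" "K \<inter> D \<noteq> {}"
  shows "K \<inter> D \<in> convex_bodies"
  using assms by (auto simp: convex_bodies_def convex_Int compact_Int_closed)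

lemma convex_hull_in_convex_bodies:
  assumes "0 < (N::nat)"
  shows "convex hull (x ` {1..N}) \<in> convex_bodies"
  using assms by (auto simp: convex_bodies_def finite_imp_compact_convex_hull)

lemma P_flat_subset_convex_bodies: "0 < N \<Longrightarrow> P_flat N a \<subseteq> convex_bodies"
  unfolding P_flat_def using convex_hull_in_convex_bodies by blast

section \<open>Inner and outer approximation of a body\<close>

lemma inner_le_of_direction_near:
  assumes "norm (u - a) \<le> \<delta>"
  shows "u \<bullet> x \<le> a \<bullet> x + \<delta> * norm x" "a \<bullet> x \<le> u \<bullet> x + \<delta> * norm x"
proof -
  have "\<bar>(u - a) \<bullet> x\<bar> \<le> norm (u - a) * norm x"
    by (rule Cauchy_Schwarz_ineq2)
  also have "\<dots> \<le> \<delta> * norm x"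
    using assms by (intro mult_right_mono) auto
  finally show "u \<bullet> x \<le> a \<bullet> x + \<delta> * norm x" "a \<bullet> x \<le> u \<bullet> x + \<delta> * norm x"
    by (auto simp: inner_diff_left)
qed

lemma argmax_inner_nonempty:
  assumes "K \<in> convex_bodies"
  shows "argmax_on (\<lambda>y. a \<bullet> y) K \<noteq> {}"
proof -
  have "\<exists>x\<in>K. \<forall>y\<in>K. a \<bullet> y \<le> a \<bullet> x"
    using assms by (intro continuous_attains_sup) (auto simp: convex_bodies_def intro: continuous_intros)
  then show ?thesis
    by (fastforce simp: argmax_on_def is_arg_max_linorder)
qed

lemma Pi_flat_nonempty:
  assumes "K \<in> convex_bodies"
  shows "Pi_flat N a K \<noteq> {}"
proof -
  have "\<forall>i. \<exists>x. x \<in> argmax_on (\<lambda>y. a i \<bullet> y) K"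
    using argmax_inner_nonempty[OF assms] by blast
  then obtain x where "\<And>i. x i \<in> argmax_on (\<lambda>y. a i \<bullet> y) K"
    by metis
  then show ?thesis
    unfolding Pi_flat_def by blast
qed

text \<open>The factor 2 counts two changes of direction, from \<open>u\<close> to a nearby
  \<open>a i\<close> at the point \<open>y\<close> and back again at the maximiser
  \<open>x i\<close>; each costs at most mesh times \<open>R\<close>. The radius is a parameter so
  that subsets of \<open>Khat\<close> can be treated with the norm of \<open>Khat\<close>.\<close>

lemma Pi_flat_approx:
  fixes a :: "nat \<Rightarrow> real ^ 'd"
  assumes a: "unit_directions N a" and N: "0 < N" and K: "K \<in> convex_bodies"
    and P: "P \<in> Pi_flat N a K" and R: "\<And>x. x \<in> K \<Longrightarrow> norm x \<le> R"
  shows "P \<in> P_flat N a" "P \<subseteq> K" "P \<in> convex_bodies"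
    "hausdorff_dist P K \<le> 2 * mesh N a * R"
proof -
  obtain x where x: "P = convex hull (x ` {1..N})"
    "\<And>i. i \<in> {1..N} \<Longrightarrow> x i \<in> argmax_on (\<lambda>y. a i \<bullet> y) K"
    using P by (auto simp: Pi_flat_def)
  have xK: "x i \<in> K" and xmax: "\<And>y. y \<in> K \<Longrightarrow> a i \<bullet> y \<le> a i \<bullet> x i" if "i \<in> {1..N}" for i
    using x(2)[OF that] by (auto simp: argmax_on_def is_arg_max_linorder)
  \<comment> \<open>Every \<open>x j\<close> lies in \<open>K\<close>, so the maximiser
    \<open>x i\<close> beats it in direction \<open>a i\<close>, which is the condition of
    \<open>C_flat\<close>.\<close>
  show Pf: "P \<in> P_flat N a"
    using xK xmax by (auto simp: x P_flat_def C_flat_def)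
  show PK: "P \<subseteq> K"
    using xK K unfolding x by (intro hull_minimal) (auto simp: convex_bodies_def)
  show Pb: "P \<in> convex_bodies"
    using Pf P_flat_subset_convex_bodies[OF N] by blast
  obtain y where y: "y \<in> K" using K by (auto simp: convex_bodies_def)
  then have R0: "0 \<le> R"
    using R norm_ge_zero order_trans by blast
  note m0 = mesh_nonneg[OF a N]
  show "hausdorff_dist P K \<le> 2 * mesh N a * R"
  proof (rule hausdorff_dist_le[OF Pb K])
    \<comment> \<open>Since \<open>P\<close> lies in \<open>K\<close>, only the other half of the
      Hausdorff distance carries information.\<close>
    fix y assume "y \<in> P"
    then show "infdist y K \<le> 2 * mesh N a * R"
      using PK m0 R0 by auto
  next
    fix y assume y: "y \<in> K"
    show "infdist y P \<le> 2 * mesh N a * R"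
    proof (rule infdist_le_support)
      show "convex P" "closed P" "P \<noteq> {}"
        using Pb by (auto simp: convex_bodies_def compact_imp_closed)
      fix u :: "real ^ 'd" assume "norm u = 1"
      then obtain i where i: "i \<in> {1..N}" "norm (u - a i) \<le> mesh N a"
        using ex_direction_near[OF a N] by blast
      have "u \<bullet> y \<le> a i \<bullet> y + mesh N a * norm y"
        by (rule inner_le_of_direction_near[OF i(2)])
      moreover have "a i \<bullet> y \<le> a i \<bullet> x i"
        by (rule xmax[OF i(1) y])
      moreover have "a i \<bullet> x i \<le> u \<bullet> x i + mesh N a * norm (x i)"
        by (rule inner_le_of_direction_near[OF i(2)])
      moreover have "mesh N a * norm y \<le> mesh N a * R" "mesh N a * norm (x i) \<le> mesh N a * R"
        using R y xK[OF i(1)] m0 by (auto intro: mult_left_mono)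
      ultimately have "u \<bullet> y \<le> u \<bullet> x i + 2 * mesh N a * R"
        by linarith
      moreover have "x i \<in> P"
        unfolding x using i(1) by (intro hull_inc) auto
      ultimately show "\<exists>c\<in>P. u \<bullet> y \<le> u \<bullet> c + 2 * mesh N a * R"
        by blast
    qed (use m0 R0 in auto)
  qed
qed

text \<open>Changing directions costs mesh times \<open>norm x\<close>, and nothing bounds
  \<open>norm x\<close> beforehand. The estimate is therefore first used to bound
  \<open>norm x\<close> itself, which works because the mesh is below 1 and the term with
  \<open>norm x\<close> can be absorbed. Substituting this bound back produces the
  denominator.\<close>

lemma Pi_sharp_bounds:
  assumes a: "unit_directions N a" and N: "0 < N" and K: "K \<in> convex_bodies"
    and m1: "mesh N a < 1" and x: "x \<in> Pi_sharp N a K"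
  shows "infdist x K \<le> 2 * mesh N a * body_norm K / (1 - mesh N a)"
proof -
  let ?\<delta> = "mesh N a" and ?R = "body_norm K"
  note m = mesh_nonneg[OF a N] m1
  have supp: "\<exists>c\<in>K. u \<bullet> x \<le> u \<bullet> c + ?\<delta> * (?R + norm x)" if u: "norm u = 1" for u
  proof -
    obtain i where i: "i \<in> {1..N}" "norm (u - a i) \<le> ?\<delta>"
      using ex_direction_near[OF a N u] by blast
    obtain c where c: "c \<in> K" "\<And>y. y \<in> K \<Longrightarrow> a i \<bullet> y \<le> a i \<bullet> c"
      using argmax_inner_nonempty[OF K, of "a i"] by (auto simp: argmax_on_def is_arg_max_linorder)
    have "a i \<bullet> x \<le> (SUP y\<in>K. a i \<bullet> y)"
      using x i(1) by (auto simp: Pi_sharp_def)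
    also have "\<dots> \<le> a i \<bullet> c"
      using c by (intro cSUP_least) auto
    finally have "a i \<bullet> x \<le> a i \<bullet> c" .
    moreover have "?\<delta> * norm c \<le> ?\<delta> * ?R"
      using norm_le_body_norm[OF K c(1)] m by (intro mult_left_mono) auto
    ultimately have "u \<bullet> x \<le> u \<bullet> c + ?\<delta> * (?R + norm x)"
      using inner_le_of_direction_near[OF i(2), of x] inner_le_of_direction_near[OF i(2), of c]
      by (simp add: distrib_left)
    then show ?thesis using c(1) by blast
  qed
  \<comment> \<open>The support estimate in the direction of \<open>x\<close> itself has
    \<open>norm x\<close> on both sides.\<close>
  have "norm x * (1 - ?\<delta>) \<le> ?R * (1 + ?\<delta>)"
  proof (cases "x = 0")
    case True
    then show ?thesis using m body_norm_nonneg[OF K] by simp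
  next
    case False
    then have n: "norm (sgn x) = 1" by (simp add: norm_sgn)
    then obtain c where c: "c \<in> K" "sgn x \<bullet> x \<le> sgn x \<bullet> c + ?\<delta> * (?R + norm x)"
      using supp by blast
    have "sgn x \<bullet> x = norm x"
      using False by (simp add: sgn_div_norm dot_square_norm power2_eq_square)
    moreover have "sgn x \<bullet> c \<le> ?R"
      using norm_cauchy_schwarz[of "sgn x" c] n norm_le_body_norm[OF K c(1)] by simp
    ultimately show ?thesis using c(2) by (simp add: algebra_simps)
  qed
  then have "norm x \<le> ?R * (1 + ?\<delta>) / (1 - ?\<delta>)"
    using m by (simp add: pos_le_divide_eq)
  then have "?\<delta> * (?R + norm x) \<le> ?\<delta> * (?R + ?R * (1 + ?\<delta>) / (1 - ?\<delta>))"
    using m by (intro mult_left_mono) auto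
  also have "\<dots> = 2 * ?\<delta> * ?R / (1 - ?\<delta>)"
    using m by (simp add: field_simps)
  finally have le: "?\<delta> * (?R + norm x) \<le> 2 * ?\<delta> * ?R / (1 - ?\<delta>)" .
  have "infdist x K \<le> ?\<delta> * (?R + norm x)"
    using K m body_norm_nonneg[OF K] supp
    by (intro infdist_le_support) (auto simp: convex_bodies_def compact_imp_closed)
  then show ?thesis using le by linarith
qed

section \<open>Blaschke selection\<close>

lemma limitin_hausdorff_iff:
  "limitin hausdorff_topology P K sequentially \<longleftrightarrow>
     K \<in> convex_bodies \<and> (\<forall>\<^sub>F n in sequentially. P n \<in> convex_bodies) \<and>
     (\<lambda>n. hausdorff_dist (P n) K) \<longlonglongrightarrow> 0"
  by (rule convex_bodies.limitin_metric_dist_null)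

lemma limitin_hausdorffI:
  assumes "K \<in> convex_bodies" "\<And>n. P n \<in> convex_bodies"
    and le: "\<And>n. hausdorff_dist (P n) K \<le> e n" and e: "e \<longlonglongrightarrow> 0"
  shows "limitin hausdorff_topology P K sequentially"
proof -
  have "(\<lambda>n. hausdorff_dist (P n) K) \<longlonglongrightarrow> 0"
    by (rule tendsto_sandwich[OF _ _ tendsto_const e])
      (auto simp: le hausdorff_dist_nonneg)
  then show ?thesis
    using assms by (simp add: limitin_hausdorff_iff)
qed

text \<open>The limit body \<open>K\<close> is the zero set of the uniform limit \<open>g\<close> of
  the distance functions. The heart of the proof is \<open>near\<close>: \<open>g\<close> dominates
  the distance to \<open>K\<close>. Uniform convergence of the distance functions then controls both
  halves of the Hausdorff distance.\<close>

lemma blaschke_selection: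
  fixes P :: "nat \<Rightarrow> (real ^ 'd) set"
  assumes P: "\<And>n. P n \<in> convex_bodies" and R: "\<And>n. P n \<subseteq> cball 0 R"
  obtains K r where "strict_mono (r :: nat \<Rightarrow> nat)" "limitin hausdorff_topology (P \<circ> r) K sequentially"
proof -
  let ?B = "cball (0 :: real ^ 'd) R"
  have Pn: "closed (P n)" "P n \<noteq> {}" "convex (P n)" for n
    using P[of n] by (auto simp: convex_bodies_def compact_imp_closed)
  have lip: "\<bar>infdist x (P n) - infdist y (P n)\<bar> \<le> dist x y" for x y n
    using infdist_triangle[of x "P n" y] infdist_triangle[of y "P n" x] by (auto simp: dist_commute)
  obtain g r where g: "continuous_on ?B g" and r: "strict_mono (r :: nat \<Rightarrow> nat)"
    and conv: "\<And>e. 0 < e \<Longrightarrow> \<exists>N. \<forall>n x. n \<ge> N \<and> x \<in> ?B \<longrightarrow> norm (infdist x (P (r n)) - g x) < e"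
  \<comment> \<open>Points of the ball and of \<open>P n\<close> both have norm at most
    \<open>R\<close>, hence the bound \<open>2 * R\<close>. All distance functions are 1-Lipschitz,
    so the modulus of equicontinuity is \<open>e\<close> itself.\<close>
  proof (rule Arzela_Ascoli[of ?B "\<lambda>n x. infdist x (P n)" "2 * R"])
    fix n and x :: "real ^ 'd" assume x: "x \<in> ?B"
    obtain p where p: "p \<in> P n" using Pn by blast
    then have "dist x p \<le> norm x + norm p"
      by (simp add: dist_norm norm_triangle_ineq4)
    moreover have "norm p \<le> R" using p R[of n] by auto
    ultimately have "infdist x (P n) \<le> 2 * R"
      using infdist_le[OF p, of x] x by simp
    then show "norm (infdist x (P n)) \<le> 2 * R"
      by (simp add: infdist_nonneg)
  next
    fix x :: "real ^ 'd" and e :: real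
    assume "0 < e"
    then show "\<exists>d>0. \<forall>n y. y \<in> ?B \<and> norm (x - y) < d \<longrightarrow> norm (infdist x (P n) - infdist y (P n)) < e"
      using lip by (intro exI[of _ e]) (auto simp: dist_norm intro: le_less_trans)
  qed auto
  have glim: "(\<lambda>n. infdist x (P (r n))) \<longlonglongrightarrow> g x" if "x \<in> ?B" for x
    using conv that unfolding LIMSEQ_def dist_real_def by fastforce
  define K where "K = {x \<in> ?B. g x = 0}"
  have g0: "0 \<le> g x" if "x \<in> ?B" for x
    using glim[OF that] by (rule LIMSEQ_le_const) (auto simp: infdist_nonneg)
  \<comment> \<open>The points of \<open>P (r n)\<close> nearest to \<open>x\<close> accumulate at
    some \<open>w\<close> with \<open>dist x w = g x\<close>. The distance of \<open>w\<close> to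
    these bodies tends to 0 along the subsequence, so \<open>g w = 0\<close>.\<close>
  have near: "\<exists>z\<in>K. dist x z \<le> g x" if x: "x \<in> ?B" for x
  proof -
    have "\<exists>z. z \<in> P (r n) \<and> infdist x (P (r n)) = dist x z" for n
      using infdist_attains_inf[OF Pn(1,2)] by metis
    then obtain z where z: "\<And>n. z n \<in> P (r n)" "\<And>n. infdist x (P (r n)) = dist x (z n)"
      by metis
    have "\<forall>n. z n \<in> ?B" using z R by blast
    then obtain w s where w: "w \<in> ?B" "strict_mono s" "(z \<circ> s) \<longlonglongrightarrow> w"
      using compact_cball[of "0 :: real ^ 'd" R] unfolding compact_def by metis
    have "(\<lambda>n. dist x (z (s n))) \<longlonglongrightarrow> dist x w"
      using w(3) by (intro tendsto_intros) (simp add: o_def)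
    moreover have "(\<lambda>n. dist x (z (s n))) \<longlonglongrightarrow> g x"
      using LIMSEQ_subseq_LIMSEQ[OF glim[OF x] w(2)] z(2) by (simp add: o_def)
    ultimately have d: "dist x w = g x"
      using LIMSEQ_unique by blast
    have "infdist w (P (r (s n))) \<le> dist w (z (s n))" for n
      by (rule infdist_le[OF z(1)])
    moreover have "(\<lambda>n. dist w (z (s n))) \<longlonglongrightarrow> dist w w"
      using w(3) by (intro tendsto_intros) (simp add: o_def)
    moreover have "(\<lambda>n. infdist w (P (r (s n)))) \<longlonglongrightarrow> g w"
      using LIMSEQ_subseq_LIMSEQ[OF glim[OF w(1)] w(2)] by (simp add: o_def)
    ultimately have "g w \<le> dist w w"
      by (intro LIMSEQ_le) auto
    then have "w \<in> K"
      using g0[OF w(1)] w(1) by (simp add: K_def)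
    then show ?thesis using d by (metis order_refl)
  qed
  have "K \<in> convex_bodies"
  proof -
    \<comment> \<open>A nonempty body in the ball forces this, so the centre 0 belongs to the ball
      and \<open>near\<close> yields a point of \<open>K\<close>.\<close>
    have "0 \<le> R"
      using Pn(2)[of 0] R[of 0] cball_eq_empty[of 0 R] by (cases "0 \<le> R") auto
    then have "K \<noteq> {}" using near[of 0] by auto
    moreover have "closed K"
      unfolding K_def by (rule continuous_closed_preimage_constant[OF g closed_cball])
    then have "compact K"
      using bounded_subset[OF bounded_cball, of K 0 R] by (simp add: compact_eq_bounded_closed K_def subset_iff)
    moreover have "convex K"
    proof (rule convexI)
      fix x y :: "real ^ 'd" and u v :: real
      assume h: "x \<in> K" "y \<in> K" "0 \<le> u" "0 \<le> v" "u + v = 1"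
      let ?w = "u *\<^sub>R x + v *\<^sub>R y"
      have B: "x \<in> ?B" "y \<in> ?B" "g x = 0" "g y = 0"
        using h by (auto simp: K_def)
      then have w: "?w \<in> ?B"
        using h by (metis convexD convex_cball)
      \<comment> \<open>Convexity of the distance functions survives the pointwise limit, and the
        zero set of a nonnegative convex function is convex.\<close>
      have "infdist ?w (P (r n)) \<le> u * infdist x (P (r n)) + v * infdist y (P (r n))" for n
        using convex_on_infdist[OF Pn(3,1,2)] h unfolding convex_on_def by blast
      moreover have "(\<lambda>n. u * infdist x (P (r n)) + v * infdist y (P (r n))) \<longlonglongrightarrow> u * g x + v * g y"
        using B by (intro tendsto_intros glim)
      ultimately have "g ?w \<le> u * g x + v * g y"
        by (intro LIMSEQ_le[OF glim[OF w]]) auto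
      then show "?w \<in> K"
        using B w g0[OF w] by (simp add: K_def)
    qed
    ultimately show ?thesis by (simp add: convex_bodies_def)
  qed
  moreover have "\<exists>N. \<forall>n\<ge>N. hausdorff_dist (P (r n)) K < e" if e: "0 < e" for e
  proof -
    obtain N where N: "\<And>n x. n \<ge> N \<Longrightarrow> x \<in> ?B \<Longrightarrow> norm (infdist x (P (r n)) - g x) < e / 2"
      using conv[of "e / 2"] e by auto
    \<comment> \<open>Suprema preserve only weak inequalities; \<open>e / 2\<close> leaves room for
      the strict one.\<close>
    have half: "hausdorff_dist (P (r n)) K \<le> e / 2" if n: "n \<ge> N" for n
    proof (rule hausdorff_dist_le)
      show "P (r n) \<in> convex_bodies" "K \<in> convex_bodies" by fact+
    next
      \<comment> \<open>Here the distance to \<open>P (r n)\<close> is 0, so \<open>g x\<close> is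
        small and \<open>near\<close> applies.\<close>
      fix x assume x: "x \<in> P (r n)"
      then have "x \<in> ?B" using R by blast
      then obtain z where "z \<in> K" "dist x z \<le> g x" using near by blast
      moreover have "g x < e / 2"
        using N[OF n \<open>x \<in> ?B\<close>] x by simp
      ultimately show "infdist x K \<le> e / 2"
        using infdist_le2[of z K x "e / 2"] by linarith
    next
      fix y assume "y \<in> K"
      then show "infdist y (P (r n)) \<le> e / 2"
        using N[OF n, of y] by (auto simp: K_def infdist_nonneg)
    qed
    then have "hausdorff_dist (P (r n)) K < e" if "n \<ge> N" for n
      using half[OF that] e by linarith
    then show ?thesis by blast
  qed
  ultimately have "limitin hausdorff_topology (P \<circ> r) K sequentially"
    using P by (simp add: convex_bodies.limit_metric_sequentially)
  then show ?thesis using r that by blast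
qed

section \<open>Compactness for a fixed direction tuple\<close>

lemma hausdorff_dist_hull_le:
  assumes N: "0 < (N::nat)" and r: "\<And>i. i \<in> {1..N} \<Longrightarrow> dist (x i) (y i) \<le> r"
  shows "hausdorff_dist (convex hull (x ` {1..N})) (convex hull (y ` {1..N})) \<le> r"
proof -
  \<comment> \<open>One half of the distance, with both tuples generalised so that it can be reused
    with their roles swapped; the parallel set of the second hull is convex, so its vertices
    suffice.\<close>
  have one: "infdist p (convex hull (y ` {1..N})) \<le> r"
    if "p \<in> convex hull (x ` {1..N})" "\<And>i. i \<in> {1..N} \<Longrightarrow> dist (x i) (y i) \<le> r"
    for p and x y :: "nat \<Rightarrow> real ^ 'a"
  proof -
    have b: "convex hull (y ` {1..N}) \<in> convex_bodies"
      by (rule convex_hull_in_convex_bodies[OF N])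
    have "convex hull (x ` {1..N}) \<subseteq> {p. infdist p (convex hull (y ` {1..N})) \<le> r}"
    proof (rule hull_minimal)
      show "x ` {1..N} \<subseteq> {p. infdist p (convex hull (y ` {1..N})) \<le> r}"
        using that(2) by (auto intro!: infdist_le2 hull_inc)
      show "convex {p. infdist p (convex hull (y ` {1..N})) \<le> r}"
        using b by (intro convex_infdist_le) (auto simp: convex_bodies_def compact_imp_closed)
    qed
    then show ?thesis using that(1) by blast
  qed
  show ?thesis
    by (intro hausdorff_dist_le convex_hull_in_convex_bodies N one)
      (auto simp: r dist_commute)
qed

text \<open>Induction over the coordinates, refining the subsequence once for each. Tuples are
  functions on a whole type, so convergence is claimed on the finite set \<open>I\<close>
  alone.\<close>

lemma compact_tuple_subseq:
  fixes D :: "'a::metric_space set"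
  assumes "compact D" "finite I" "\<And>n i. i \<in> I \<Longrightarrow> x n i \<in> D"
  shows "\<exists>r y. strict_mono (r :: nat \<Rightarrow> nat) \<and> (\<forall>i\<in>I. y i \<in> D \<and> (\<lambda>n. x (r n) i) \<longlonglongrightarrow> y i)"
  using assms(2,3)
proof (induction I)
  case empty
  show ?case by (intro exI[of _ id]) (auto simp: strict_mono_def)
next
  case (insert j I)
  then obtain r y where r: "strict_mono (r :: nat \<Rightarrow> nat)"
    and y: "\<forall>i\<in>I. y i \<in> D \<and> (\<lambda>n. x (r n) i) \<longlonglongrightarrow> y i"
    by (metis insertCI)
  have "\<forall>n. x (r n) j \<in> D" using insert by auto
  then obtain z s where z: "z \<in> D" "strict_mono s" "((\<lambda>n. x (r n) j) \<circ> s) \<longlonglongrightarrow> z"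
    using \<open>compact D\<close> unfolding compact_def by metis
  have "(\<lambda>n. x ((r \<circ> s) n) i) \<longlonglongrightarrow> y i" if "i \<in> I" for i
    using LIMSEQ_subseq_LIMSEQ[OF conjunct2[OF bspec[OF y that]] z(2)] by (simp add: o_def)
  then have "\<forall>i\<in>insert j I. (y(j := z)) i \<in> D \<and> (\<lambda>n. x ((r \<circ> s) n) i) \<longlonglongrightarrow> (y(j := z)) i"
    using z y insert(2) by (auto simp: o_def)
  then show ?case
    using strict_mono_o[OF r z(2)] by blast
qed

text \<open>Blaschke selection would not show that the limit is again in \<open>P_flat\<close>. The
  limit is taken of the vertex tuples instead: the inequalities of \<open>C_flat\<close> are closed,
  and hulls depend continuously on their vertices.\<close>

lemma P_flat_subseq:
  fixes D :: "(real ^ 'd) set"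
  assumes N: "0 < N" and D: "compact D" "convex D"
    and P: "\<And>n. P n \<in> P_flat N a" "\<And>n. P n \<subseteq> D"
  obtains K r where "strict_mono (r :: nat \<Rightarrow> nat)" "limitin hausdorff_topology (P \<circ> r) K sequentially"
    "K \<in> P_flat N a" "K \<subseteq> D"
proof -
  have "\<forall>n. \<exists>x. P n = convex hull (x ` {1..N}) \<and> x \<in> C_flat N a"
    using P(1) by (auto simp: P_flat_def)
  then obtain x where x: "\<And>n. P n = convex hull (x n ` {1..N})" "\<And>n. x n \<in> C_flat N a"
    by metis
  have "x n i \<in> D" if "i \<in> {1..N}" for n i
    using P(2)[of n] hull_inc[of "x n i" "x n ` {1..N}" convex] that by (auto simp: x(1))
  then obtain r y where r: "strict_mono (r :: nat \<Rightarrow> nat)"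
    and y: "\<And>i. i \<in> {1..N} \<Longrightarrow> y i \<in> D" "\<And>i. i \<in> {1..N} \<Longrightarrow> (\<lambda>n. x (r n) i) \<longlonglongrightarrow> y i"
    using compact_tuple_subseq[OF D(1), of "{1..N}" x] finite_atLeastAtMost by metis
  have "a i \<bullet> y j \<le> a i \<bullet> y i" if "i \<in> {1..N}" "j \<in> {1..N}" "i \<noteq> j" for i j
  proof (rule LIMSEQ_le)
    show "(\<lambda>n. a i \<bullet> x (r n) j) \<longlonglongrightarrow> a i \<bullet> y j" "(\<lambda>n. a i \<bullet> x (r n) i) \<longlonglongrightarrow> a i \<bullet> y i"
      by (intro tendsto_intros y that)+
    show "\<exists>M. \<forall>n\<ge>M. a i \<bullet> x (r n) j \<le> a i \<bullet> x (r n) i"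
      using x(2) that by (auto simp: C_flat_def)
  qed
  then have Pf: "convex hull (y ` {1..N}) \<in> P_flat N a"
    by (auto simp: P_flat_def C_flat_def)
  moreover have "convex hull (y ` {1..N}) \<subseteq> D"
    using y(1) D(2) by (intro hull_minimal) auto
  moreover have "limitin hausdorff_topology (P \<circ> r) (convex hull (y ` {1..N})) sequentially"
  proof (rule limitin_hausdorffI)
    \<comment> \<open>The sum of the vertex displacements dominates each of them and visibly tends
      to 0.\<close>
    show "hausdorff_dist ((P \<circ> r) n) (convex hull (y ` {1..N})) \<le> (\<Sum>i\<in>{1..N}. dist (x (r n) i) (y i))" for n
      unfolding comp_apply x(1) by (intro hausdorff_dist_hull_le N member_le_sum) auto
    have "(\<lambda>n. dist (x (r n) i) (y i)) \<longlonglongrightarrow> 0" if "i \<in> {1..N}" for i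
      using tendsto_dist[OF y(2)[OF that] tendsto_const[of "y i"]] by simp
    then show "(\<lambda>n. \<Sum>i\<in>{1..N}. dist (x (r n) i) (y i)) \<longlonglongrightarrow> 0"
      by (rule tendsto_null_sum)
  qed (auto simp: x(1) convex_hull_in_convex_bodies[OF N] simp del: One_nat_def)
  ultimately show ?thesis using r that by blast
qed

section \<open>Limits of constraints and existence of minimisers\<close>

text \<open>A convergent sequence together with its limit lies in a ball around the limit, so a
  single Lipschitz constant serves for all its members.\<close>

lemma lipschitz_on_bodies_limit:
  fixes \<Psi> :: "(real ^ 'd) set \<Rightarrow> real ^ 'm"
  assumes lip: "\<And>\<A>. \<A> \<subseteq> convex_bodies \<Longrightarrow> convex_bodies.mbounded \<A> \<Longrightarrow> \<exists>L. lipschitz_on_bodies L \<Psi> \<A>"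
    and lim: "limitin hausdorff_topology P K sequentially" and P: "\<And>n. P n \<in> convex_bodies"
  shows "(\<lambda>n. \<Psi> (P n) $ i) \<longlonglongrightarrow> \<Psi> K $ i"
proof -
  let ?A = "insert K (range P)"
  have K: "K \<in> convex_bodies" and d: "(\<lambda>n. hausdorff_dist (P n) K) \<longlonglongrightarrow> 0"
    using lim by (auto simp: limitin_hausdorff_iff)
  have "Bseq (\<lambda>n. hausdorff_dist (P n) K)"
    using d by (intro convergent_imp_Bseq) (auto simp: convergent_def)
  then obtain B where "0 < B" and le: "\<And>n. norm (hausdorff_dist (P n) K) \<le> B"
    by (auto simp: Bseq_def)
  have B: "hausdorff_dist K K \<le> B" "hausdorff_dist K (P n) \<le> B" for n
    using K \<open>0 < B\<close> le[of n] by (auto simp: hausdorff_dist_commute[of K "P n"])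
  have "convex_bodies.mbounded ?A"
    unfolding convex_bodies.mbounded using K P B by blast
  then obtain L where L: "lipschitz_on_bodies L \<Psi> ?A"
    using lip[of ?A] K P by blast
  have "\<bar>\<Psi> (P n) $ i - \<Psi> K $ i\<bar> \<le> L * hausdorff_dist (P n) K" for n
  proof -
    have "infnorm (\<Psi> (P n) - \<Psi> K) \<le> L * hausdorff_dist (P n) K"
      using L by (simp add: lipschitz_on_bodies_def)
    then show ?thesis
      using component_le_infnorm_cart[of "\<Psi> (P n) - \<Psi> K" i] by simp
  qed
  then have "(\<lambda>n. \<Psi> (P n) $ i - \<Psi> K $ i) \<longlonglongrightarrow> 0"
    by (intro Lim_null_comparison[OF _ tendsto_mult_right_zero[OF d, of L]]) auto
  then show ?thesis
    by (simp add: LIM_zero_iff)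
qed

text \<open>The direct method by contradiction. The infimum is taken in the extended reals, so a
  minimising sequence exists before \<open>f\<close> is known to be bounded below.\<close>

lemma lower_semicontinuous_argmin_nonempty:
  assumes lsc: "lower_semicontinuous_map X f" and S: "S \<noteq> {}"
    and cpt: "\<And>u. (\<And>n. u n \<in> S) \<Longrightarrow> \<exists>r x. strict_mono (r :: nat \<Rightarrow> nat) \<and> limitin X (u \<circ> r) x sequentially \<and> x \<in> S"
  shows "argmin_on f S \<noteq> {}"
proof
  assume "argmin_on f S = {}"
  then have no_min: "\<exists>y\<in>S. f y < f x" if "x \<in> S" for x
    using that by (auto simp: argmin_on_def is_arg_min_def)
  obtain v where v: "\<And>n. v n \<in> (\<lambda>x. ereal (f x)) ` S" "v \<longlonglongrightarrow> (INF x\<in>S. ereal (f x))"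
    using Inf_as_limit[of "(\<lambda>x. ereal (f x)) ` S"] S by blast
  then have "\<forall>n. \<exists>x. x \<in> S \<and> v n = ereal (f x)" by blast
  then obtain u where u: "\<And>n. u n \<in> S" "\<And>n. v n = ereal (f (u n))" by metis
  \<comment> \<open>Without a minimiser every value \<open>f y\<close> lies strictly above the
    infimum, so the sequence eventually drops below it. Lower semicontinuity at the limit
    \<open>x\<close> forbids this for a \<open>y\<close> that beats \<open>x\<close>.\<close>
  have ev: "\<forall>\<^sub>F n in sequentially. f (u n) < f y" if y: "y \<in> S" for y
  proof -
    obtain z where "z \<in> S" "f z < f y" using no_min[OF y] by blast
    then have "(INF x\<in>S. ereal (f x)) < ereal (f y)"
      by (auto simp: INF_less_iff)
    from order_tendstoD(2)[OF v(2) this] show ?thesis by (simp add: u(2))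
  qed
  obtain r x where r: "strict_mono (r :: nat \<Rightarrow> nat)" and x: "limitin X (u \<circ> r) x sequentially" "x \<in> S"
    using cpt[of u] u(1) by blast
  obtain y where y: "y \<in> S" "f y < f x" using no_min[OF x(2)] by blast
  have "x \<in> topspace X"
    using x(1) by (simp add: limitin_def)
  then have "\<exists>U. openin X U \<and> x \<in> U \<and> (\<forall>z\<in>U. f y < f z)"
    using lsc y(2) by (simp add: lower_semicontinuous_map_def)
  then obtain U where U: "openin X U" "x \<in> U" "\<forall>z\<in>U. f y < f z" by blast
  have "\<forall>\<^sub>F n in sequentially. u (r n) \<in> U"
    using x(1) U(1,2) by (simp add: limitin_def)
  then have "\<forall>\<^sub>F n in sequentially. f y < f (u (r n))"
    by eventually_elim (use U(3) in blast)
  moreover have "\<forall>\<^sub>F n in sequentially. f (u (r n)) < f y"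
    using eventually_subseq[OF r ev[OF y(1)]] .
  ultimately have "\<forall>\<^sub>F n in sequentially. False"
    by eventually_elim simp
  then show False by simp
qed

lemma continuous_map_hausdorff_limit:
  assumes "continuous_map hausdorff_topology euclideanreal \<Phi>"
    and "limitin hausdorff_topology P K sequentially"
  shows "(\<lambda>n. \<Phi> (P n)) \<longlonglongrightarrow> \<Phi> K"
  using continuous_map_limit[OF assms] by (simp add: o_def)

lemma limitin_hausdorff_subseq:
  assumes "limitin hausdorff_topology P K sequentially" "strict_mono r"
  shows "limitin hausdorff_topology (P \<circ> r) K sequentially"
  using limitin_subsequence[OF assms(2,1)] .

section \<open>Convergence of minimiser sets\<close>

lemma hausdorff_excess_tendsto_0:
  assumes A: "\<And>k. A k \<noteq> {}"
    and ev: "\<And>e. 0 < e \<Longrightarrow> \<forall>\<^sub>F k in sequentially. \<forall>P\<in>A k. \<exists>K\<in>B. hausdorff_dist P K < e"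
  shows "(\<lambda>k. hausdorff_excess (A k) B) \<longlonglongrightarrow> 0"
proof (rule order_tendstoI)
  fix e :: ereal assume e: "e < 0"
  \<comment> \<open>Nonemptiness of \<open>A k\<close> rules out the value minus infinity of an
    empty supremum.\<close>
  have "0 \<le> hausdorff_excess (A k) B" for k
  proof -
    obtain P where "P \<in> A k" using A by blast
    then show ?thesis
      unfolding hausdorff_excess_def
      by (rule SUP_upper2) (auto intro!: INF_greatest simp: hausdorff_dist_nonneg)
  qed
  then show "\<forall>\<^sub>F k in sequentially. e < hausdorff_excess (A k) B"
    using e by (intro always_eventually allI) (meson less_le_trans)
next
  fix e :: ereal assume "0 < e"
  \<comment> \<open>A real strictly between 0 and \<open>e\<close> absorbs the loss of strictness in
    the supremum and gives \<open>ev\<close> a real bound.\<close>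
  then obtain z where z: "0 < ereal z" "ereal z < e"
    using ereal_dense2 by blast
  then have "\<forall>\<^sub>F k in sequentially. \<forall>P\<in>A k. \<exists>K\<in>B. hausdorff_dist P K < z"
    by (intro ev) simp
  then show "\<forall>\<^sub>F k in sequentially. hausdorff_excess (A k) B < e"
  proof eventually_elim
    case (elim k)
    have "hausdorff_excess (A k) B \<le> ereal z"
      unfolding hausdorff_excess_def
    proof (rule SUP_least)
      fix P assume "P \<in> A k"
      then obtain K where K: "K \<in> B" "hausdorff_dist P K < z" using elim by blast
      show "(INF K'\<in>B. ereal (hausdorff_dist P K')) \<le> ereal z"
        by (rule INF_lower2[OF K(1)]) (use K(2) in simp)
    qed
    then show ?case using z(2) by (rule le_less_trans)
  qed
qed

text \<open>Together \<open>outer\<close> and \<open>inner\<close> express Kuratowski convergence of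
  \<open>Mk\<close> to \<open>M\<close>: cluster points are feasible, and every feasible body has a
  recovery sequence. With uniformly close objectives, cluster points of minimisers are
  minimisers.\<close>

lemma argmin_convergence:
  fixes \<Phi> :: "(real ^ 'd) set \<Rightarrow> real" and Mk :: "nat \<Rightarrow> (real ^ 'd) set set"
  assumes \<Phi>: "continuous_map hausdorff_topology euclideanreal \<Phi>"
    and Mk: "\<And>k. Mk k \<subseteq> convex_bodies" "\<And>k P. P \<in> Mk k \<Longrightarrow> P \<subseteq> cball 0 R"
    and cpt: "\<And>k P. (\<And>n. P n \<in> Mk k) \<Longrightarrow>
      \<exists>r K. strict_mono (r :: nat \<Rightarrow> nat) \<and> limitin hausdorff_topology (P \<circ> r) K sequentially \<and> K \<in> Mk k"
    and outer: "\<And>r P K. strict_mono (r :: nat \<Rightarrow> nat) \<Longrightarrow> (\<And>n. P n \<in> Mk (r n)) \<Longrightarrow>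
      limitin hausdorff_topology P K sequentially \<Longrightarrow> K \<in> M"
    and inner: "\<And>L. L \<in> M \<Longrightarrow> \<exists>Q. (\<forall>k. Q k \<in> Mk k) \<and> limitin hausdorff_topology Q L sequentially"
    and M: "M \<noteq> {}"
    and lsc: "\<And>k. lower_semicontinuous_map hausdorff_topology (\<Phi>k k)"
    and sup: "(\<lambda>k. SUP K\<in>Mk k. ereal \<bar>\<Phi> K - \<Phi>k k K\<bar>) \<longlonglongrightarrow> 0"
  shows "argmin_on \<Phi> M \<noteq> {}" "\<And>k. argmin_on (\<Phi>k k) (Mk k) \<noteq> {}"
    "(\<lambda>k. hausdorff_excess (argmin_on (\<Phi>k k) (Mk k)) (argmin_on \<Phi> M)) \<longlonglongrightarrow> 0"
proof -
  let ?A = "\<lambda>k. argmin_on (\<Phi>k k) (Mk k)"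
  have Mk_ne: "Mk k \<noteq> {}" for k
    using M inner by blast
  show ne: "?A k \<noteq> {}" for k
    by (rule lower_semicontinuous_argmin_nonempty[OF lsc Mk_ne cpt])
  have close: "\<forall>\<^sub>F k in sequentially. \<forall>K\<in>Mk k. \<bar>\<Phi> K - \<Phi>k k K\<bar> < e" if e: "0 < e" for e
  proof -
    have "0 < ereal e" using e by simp
    from order_tendstoD(2)[OF sup this] show ?thesis
    proof eventually_elim
      case (elim k)
      then have "ereal \<bar>\<Phi> K - \<Phi>k k K\<bar> < ereal e" if "K \<in> Mk k" for K
        using that by (meson SUP_upper le_less_trans)
      then show ?case by simp
    qed
  qed
  have sub: "\<exists>s K. strict_mono (s :: nat \<Rightarrow> nat) \<and> limitin hausdorff_topology (P \<circ> s) K sequentially \<and> K \<in> argmin_on \<Phi> M"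
    if r: "strict_mono (r :: nat \<Rightarrow> nat)" and P: "\<And>n. P n \<in> ?A (r n)" for r P
  proof -
    have PM: "P n \<in> Mk (r n)" and Pmin: "\<And>Q. Q \<in> Mk (r n) \<Longrightarrow> \<Phi>k (r n) (P n) \<le> \<Phi>k (r n) Q" for n
      using P[of n] by (auto simp: argmin_on_def is_arg_min_linorder)
    \<comment> \<open>The feasible set changes along the sequence, so \<open>cpt\<close>, which
      concerns a fixed \<open>k\<close>, does not apply; the common ball is what gives a
      limit.\<close>
    obtain K s where s: "strict_mono (s :: nat \<Rightarrow> nat)"
      and K: "limitin hausdorff_topology (P \<circ> s) K sequentially"
    proof (rule blaschke_selection[of P R])
      show "P n \<in> convex_bodies" "P n \<subseteq> cball 0 R" for n
        using PM[of n] Mk by auto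
    qed
    have rs: "strict_mono (r \<circ> s)" using strict_mono_o[OF r s] .
    have KM: "K \<in> M"
      by (rule outer[OF rs _ K]) (simp add: PM)
    have "\<Phi> K \<le> \<Phi> L" if L: "L \<in> M" for L
    proof (rule field_le_epsilon)
      fix e :: real assume e: "0 < e"
      obtain Q where Q: "\<And>k. Q k \<in> Mk k" "limitin hausdorff_topology Q L sequentially"
        using inner[OF L] by blast
      \<comment> \<open>The objective is exchanged twice, at the minimiser and at the recovery
        polytope \<open>Q\<close>, at cost \<open>e / 2\<close> each.\<close>
      have "0 < e / 2" using e by simp
      from eventually_subseq[OF rs close[OF this]]
      have "\<forall>\<^sub>F n in sequentially. \<Phi> ((P \<circ> s) n) \<le> \<Phi> ((Q \<circ> (r \<circ> s)) n) + e"
      proof eventually_elim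
        case (elim n)
        let ?k = "r (s n)"
        have "\<bar>\<Phi> (P (s n)) - \<Phi>k ?k (P (s n))\<bar> < e / 2" "\<bar>\<Phi> (Q ?k) - \<Phi>k ?k (Q ?k)\<bar> < e / 2"
          using elim PM[of "s n"] Q(1)[of ?k] by simp_all
        moreover have "\<Phi>k ?k (P (s n)) \<le> \<Phi>k ?k (Q ?k)"
          by (rule Pmin[OF Q(1)])
        ultimately have "\<Phi> (P (s n)) \<le> \<Phi> (Q ?k) + e"
          by linarith
        then show ?case by simp
      qed
      moreover have "(\<lambda>n. \<Phi> ((P \<circ> s) n)) \<longlonglongrightarrow> \<Phi> K"
        by (rule continuous_map_hausdorff_limit[OF \<Phi> K])
      moreover have "(\<lambda>n. \<Phi> ((Q \<circ> (r \<circ> s)) n) + e) \<longlonglongrightarrow> \<Phi> L + e"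
        by (intro tendsto_add tendsto_const continuous_map_hausdorff_limit[OF \<Phi>]
            limitin_hausdorff_subseq[OF Q(2) rs])
      ultimately show "\<Phi> K \<le> \<Phi> L + e"
        by (intro tendsto_le[OF sequentially_bot])
    qed
    then have "K \<in> argmin_on \<Phi> M"
      using KM by (simp add: argmin_on_def is_arg_min_linorder)
    then show ?thesis using s K by blast
  qed
  have "\<forall>n. \<exists>P. P \<in> ?A n"
    using ne by (simp add: ex_in_conv)
  from choice[OF this] obtain P where "\<forall>n. P n \<in> ?A n" ..
  then show "argmin_on \<Phi> M \<noteq> {}"
    \<comment> \<open>With the full sequence of indices, the cluster point of the approximate
      minimisers is itself the required minimiser.\<close>
    using sub[of id P] by (auto simp: strict_mono_id)
  show "(\<lambda>k. hausdorff_excess (?A k) (argmin_on \<Phi> M)) \<longlonglongrightarrow> 0"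
  \<comment> \<open>Otherwise infinitely many approximate minimisers stay at distance at least
    \<open>e\<close> from all minimisers of \<open>\<Phi>\<close>, but a subsequence of them
    converges to one.\<close>
  proof (rule hausdorff_excess_tendsto_0[OF ne], rule ccontr)
    fix e :: real assume e: "0 < e"
    assume "\<not> (\<forall>\<^sub>F k in sequentially. \<forall>P\<in>?A k. \<exists>K\<in>argmin_on \<Phi> M. hausdorff_dist P K < e)"
    from not_eventually_sequentiallyD[OF this] obtain r
      where r: "strict_mono (r :: nat \<Rightarrow> nat)"
        and "\<forall>n. \<exists>P. P \<in> ?A (r n) \<and> (\<forall>K\<in>argmin_on \<Phi> M. \<not> hausdorff_dist P K < e)"
      by (elim exE conjE) (simp add: Bex_def Ball_def)
    from this(2) obtain P where P: "\<And>n. P n \<in> ?A (r n)"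
      "\<And>n K. K \<in> argmin_on \<Phi> M \<Longrightarrow> \<not> hausdorff_dist (P n) K < e"
      by metis
    obtain s K where K: "limitin hausdorff_topology (P \<circ> s) K sequentially" "K \<in> argmin_on \<Phi> M"
      using sub[OF r P(1)] by blast
    have "(\<lambda>n. hausdorff_dist ((P \<circ> s) n) K) \<longlonglongrightarrow> 0"
      using K(1) unfolding limitin_hausdorff_iff by blast
    from order_tendstoD(2)[OF this e] show False
      using P(2)[OF K(2)] by simp
  qed
qed

text \<open>The slack \<open>c k = l * b k\<close> is exactly what the Lipschitz constant needs to
  keep a polytope at distance \<open>b k\<close> from a feasible body admissible. The sequence
  \<open>e\<close> measures how far the container protrudes from \<open>Khat\<close>.\<close>

lemma galerkin_argmin_convergence:
  fixes \<Phi> :: "(real ^ 'd) set \<Rightarrow> real" and \<Psi> :: "(real ^ 'd) set \<Rightarrow> real ^ 'm"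
    and a :: "nat \<Rightarrow> nat \<Rightarrow> real ^ 'd" and D :: "nat \<Rightarrow> (real ^ 'd) set"
  assumes \<Phi>: "continuous_map hausdorff_topology euclideanreal \<Phi>"
    and lip: "\<And>\<A>. \<A> \<subseteq> convex_bodies \<Longrightarrow> convex_bodies.mbounded \<A> \<Longrightarrow> \<exists>L. lipschitz_on_bodies L \<Psi> \<A>"
    and Khat: "Khat \<in> convex_bodies" and M: "feasible \<Psi> Khat \<noteq> {}"
    and N: "\<And>k. 0 < N k" and l: "0 \<le> l"
    and D: "\<And>k. compact (D k)" "\<And>k. convex (D k)"
      "\<And>k x. x \<in> D k \<Longrightarrow> infdist x Khat \<le> e k" and e: "e \<longlonglongrightarrow> 0"
    and lipM: "\<And>k. lipschitz_on_bodies l \<Psi> (feasible \<Psi> Khat \<union> {P \<in> P_flat (N k) (a k). P \<subseteq> D k})"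
    and approx: "\<And>k L. L \<in> feasible \<Psi> Khat \<Longrightarrow>
      \<exists>Q\<in>P_flat (N k) (a k). Q \<subseteq> D k \<and> hausdorff_dist Q L \<le> b k"
    and b: "b \<longlonglongrightarrow> 0" and c: "\<And>k. c k = l * b k"
    and lsc: "\<And>k. lower_semicontinuous_map hausdorff_topology (\<Phi>k k)"
  defines "Mk \<equiv> \<lambda>k. {P \<in> P_flat (N k) (a k). \<Psi> P - c k *\<^sub>R vec 1 \<le> 0 \<and> P \<subseteq> D k}"
  assumes sup: "(\<lambda>k. SUP K\<in>Mk k. ereal \<bar>\<Phi> K - \<Phi>k k K\<bar>) \<longlonglongrightarrow> 0"
  shows "argmin_on \<Phi> (feasible \<Psi> Khat) \<noteq> {} \<and>
    (\<forall>k. argmin_on (\<Phi>k k) (Mk k) \<noteq> {}) \<and>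
    (\<lambda>k. hausdorff_excess (argmin_on (\<Phi>k k) (Mk k)) (argmin_on \<Phi> (feasible \<Psi> Khat))) \<longlonglongrightarrow> 0"
proof -
  let ?M = "feasible \<Psi> Khat"
  have Mk: "P \<in> Mk k \<longleftrightarrow> P \<in> P_flat (N k) (a k) \<and> (\<forall>i. \<Psi> P $ i \<le> c k) \<and> P \<subseteq> D k" for P k
    by (auto simp: Mk_def less_eq_vec_def)
  have Mk_bodies: "Mk k \<subseteq> convex_bodies" for k
    using P_flat_subset_convex_bodies[OF N] by (auto simp: Mk_def)
  have Khat': "closed Khat" "Khat \<noteq> {}"
    using Khat by (auto simp: convex_bodies_def compact_imp_closed)
  have "Bseq e"
    using e by (intro convergent_imp_Bseq) (auto simp: convergent_def)
  then obtain B where B: "\<And>n. norm (e n) \<le> B"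
    by (auto simp: Bseq_def)
  \<comment> \<open>Boundedness of the convergent sequence \<open>e\<close> puts the polytopes of
    all levels into one ball.\<close>
  have R: "P \<subseteq> cball 0 (B + body_norm Khat)" if "P \<in> Mk k" for k P
  proof
    fix x assume "x \<in> P"
    then have "infdist x Khat \<le> e k" using that D(3) by (auto simp: Mk)
    then have "infdist x Khat \<le> B" using B[of k] by simp
    moreover obtain y where y: "y \<in> Khat" "infdist x Khat = dist x y"
      using infdist_attains_inf[OF Khat'] by blast
    ultimately show "x \<in> cball 0 (B + body_norm Khat)"
      using norm_le_body_norm[OF Khat y(1)] norm_triangle_sub[of x y] by (simp add: dist_norm)
  qed
  have b0: "c \<longlonglongrightarrow> 0"
  proof -
    have "c = (\<lambda>k. l * b k)" by (rule ext) (rule c)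
    then show ?thesis using tendsto_mult_right_zero[OF b, of l] by simp
  qed
  note \<Psi>lim = lipschitz_on_bodies_limit[OF lip]
  have 1: "\<exists>r K. strict_mono (r :: nat \<Rightarrow> nat) \<and> limitin hausdorff_topology (P \<circ> r) K sequentially \<and> K \<in> Mk k"
    if P: "\<And>n. P n \<in> Mk k" for k P
  proof (rule P_flat_subseq[OF N[of k] D(1)[of k] D(2)[of k], of P "a k"])
    show "P n \<in> P_flat (N k) (a k)" "P n \<subseteq> D k" for n
      using P by (auto simp: Mk)
    fix r K
    assume r: "strict_mono (r :: nat \<Rightarrow> nat)" and K: "limitin hausdorff_topology (P \<circ> r) K sequentially"
      "K \<in> P_flat (N k) (a k)" "K \<subseteq> D k"
    have "\<Psi> K $ i \<le> c k" for i
    proof (rule LIMSEQ_le_const2)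
      show "(\<lambda>n. \<Psi> ((P \<circ> r) n) $ i) \<longlonglongrightarrow> \<Psi> K $ i"
        using P Mk_bodies by (intro \<Psi>lim K(1)) auto
      show "\<exists>m. \<forall>n\<ge>m. \<Psi> ((P \<circ> r) n) $ i \<le> c k"
        using P by (simp add: Mk)
    qed
    then show ?thesis using r K by (auto simp: Mk)
  qed
  have 2: "K \<in> ?M"
    if r: "strict_mono (r :: nat \<Rightarrow> nat)" and P: "\<And>n. P n \<in> Mk (r n)"
      and K: "limitin hausdorff_topology P K sequentially" for r P K
  proof -
    have Pb: "P n \<in> convex_bodies" for n using P Mk_bodies by blast
    have Kb: "K \<in> convex_bodies" and d: "(\<lambda>n. hausdorff_dist (P n) K) \<longlonglongrightarrow> 0"
      using K by (auto simp: limitin_hausdorff_iff)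
    have "x \<in> Khat" if x: "x \<in> K" for x
    proof -
      \<comment> \<open>Go from \<open>x\<close> to its nearest point in \<open>P n\<close>, and
        from there to \<open>Khat\<close>.\<close>
      have "infdist x Khat \<le> e (r n) + hausdorff_dist (P n) K" for n
      proof -
        have "closed (P n)" "P n \<noteq> {}"
          using Pb[of n] by (auto simp: convex_bodies_def compact_imp_closed)
        then obtain y where y: "y \<in> P n" "infdist x (P n) = dist x y"
          using infdist_attains_inf by blast
        have "infdist y Khat \<le> e (r n)"
          using y(1) P[of n] D(3) by (auto simp: Mk)
        then show ?thesis
          using infdist_triangle[of x Khat y] y(2) infdist_le_hausdorff_dist(2)[OF Pb Kb x, of n]
          by linarith
      qed
      moreover have "(\<lambda>n. e (r n) + hausdorff_dist (P n) K) \<longlonglongrightarrow> 0 + 0"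
        using LIMSEQ_subseq_LIMSEQ[OF e r] d by (intro tendsto_add) (simp_all add: o_def)
      ultimately have "infdist x Khat \<le> 0 + 0"
        by (intro LIMSEQ_le_const) auto
      then have "infdist x Khat = 0"
        using infdist_nonneg[of x Khat] by simp
      then show ?thesis
        using in_closed_iff_infdist_zero[OF Khat'] by blast
    qed
    \<comment> \<open>The constant \<open>l\<close> is not yet available at \<open>K\<close>, whose
      feasibility is being proved; the Lipschitz property on bounded collections supplies the
      limit.\<close>
    moreover have "\<Psi> K $ i \<le> 0" for i
    proof (rule LIMSEQ_le)
      show "(\<lambda>n. \<Psi> (P n) $ i) \<longlonglongrightarrow> \<Psi> K $ i"
        by (intro \<Psi>lim K Pb)
      show "(\<lambda>n. c (r n)) \<longlonglongrightarrow> 0"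
        using LIMSEQ_subseq_LIMSEQ[OF b0 r] by (simp add: o_def)
      show "\<exists>m. \<forall>n\<ge>m. \<Psi> (P n) $ i \<le> c (r n)"
        using P by (simp add: Mk)
    qed
    ultimately show ?thesis
      using Kb by (auto simp: feasible_def less_eq_vec_def)
  qed
  have 3: "\<exists>Q. (\<forall>k. Q k \<in> Mk k) \<and> limitin hausdorff_topology Q L sequentially" if L: "L \<in> ?M" for L
  proof -
    have "\<forall>k. \<exists>Q. Q \<in> P_flat (N k) (a k) \<and> Q \<subseteq> D k \<and> hausdorff_dist Q L \<le> b k"
      using approx[OF L] by blast
    from choice[OF this] obtain Q where Q: "\<And>k. Q k \<in> P_flat (N k) (a k)"
      "\<And>k. Q k \<subseteq> D k" "\<And>k. hausdorff_dist (Q k) L \<le> b k" by blast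
    \<comment> \<open>Each component of \<open>\<Psi>\<close> rises by at most
      \<open>l * b k\<close> from its nonpositive value at \<open>L\<close>.\<close>
    have "\<Psi> (Q k) $ i \<le> c k" for k i
    proof -
      have "infnorm (\<Psi> (Q k) - \<Psi> L) \<le> l * hausdorff_dist (Q k) L"
        using lipM[of k] L Q by (simp add: lipschitz_on_bodies_def)
      also have "\<dots> \<le> c k"
        unfolding c using Q(3) l by (rule mult_left_mono)
      finally have "\<Psi> (Q k) $ i - \<Psi> L $ i \<le> c k"
        using component_le_infnorm_cart[of "\<Psi> (Q k) - \<Psi> L" i] by simp
      moreover have "\<Psi> L $ i \<le> 0"
        using L by (simp add: feasible_def less_eq_vec_def)
      ultimately show ?thesis by simp
    qed
    then have QM: "Q k \<in> Mk k" for k using Q by (simp add: Mk)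
    moreover have "limitin hausdorff_topology Q L sequentially"
      using L QM Mk_bodies Q(3) by (intro limitin_hausdorffI[OF _ _ _ b]) (auto simp: feasible_def)
    ultimately show ?thesis by blast
  qed
  note conv = argmin_convergence[where Mk = Mk and R = "B + body_norm Khat" and M = ?M and \<Phi>k = \<Phi>k, OF \<Phi>]
  show ?thesis
  proof (intro conjI allI)
    show "argmin_on \<Phi> ?M \<noteq> {}"
      by (rule conv(1)) (fact Mk_bodies R 1 2 3 M lsc sup)+
    show "argmin_on (\<Phi>k k) (Mk k) \<noteq> {}" for k
      by (rule conv(2)) (fact Mk_bodies R 1 2 3 M lsc sup)+
    show "(\<lambda>k. hausdorff_excess (argmin_on (\<Phi>k k) (Mk k)) (argmin_on \<Phi> ?M)) \<longlonglongrightarrow> 0"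
      by (rule conv(3)) (fact Mk_bodies R 1 2 3 M lsc sup)+
  qed
qed

section \<open>Approximating polytopes in the three containers\<close>

text \<open>The body of points of \<open>Phat\<close> within distance \<open>2 \<cdot> mesh \<cdot> R\<close> of \<open>L\<close> sits between \<open>L\<close>
  and its polytope, which costs a second factor of two.\<close>

lemma Pi_flat_approx_in_Pi_flat:
  fixes a :: "nat \<Rightarrow> real ^ 'd"
  assumes a: "unit_directions N a" and N: "0 < N" and Khat: "Khat \<in> convex_bodies"
    and Phat: "Phat \<in> Pi_flat N a Khat" and L: "L \<in> convex_bodies" "L \<subseteq> Khat"
  shows "\<exists>Q\<in>P_flat N a. Q \<subseteq> Phat \<and> hausdorff_dist Q L \<le> 4 * mesh N a * body_norm Khat"
proof -
  let ?d = "2 * mesh N a * body_norm Khat"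
  note R = norm_le_body_norm[OF Khat]
  note P = Pi_flat_approx[OF a N Khat Phat R]
  have Lc: "convex L" "closed L" "L \<noteq> {}"
    using L by (auto simp: convex_bodies_def compact_imp_closed)
  have Pc: "closed Phat" "Phat \<noteq> {}"
    using P(3) by (auto simp: convex_bodies_def compact_imp_closed)
  define K where "K = Phat \<inter> {x. infdist x L \<le> ?d}"
  have near: "\<exists>x\<in>K. dist y x \<le> ?d" if y: "y \<in> L" for y
  proof -
    obtain x where x: "x \<in> Phat" "infdist y Phat = dist y x"
      using infdist_attains_inf[OF Pc] by blast
    have "dist y x \<le> ?d"
      using infdist_le_hausdorff_dist(2)[OF P(3) Khat, of y] y L(2) P(4) x(2) by auto
    then show ?thesis
      using x(1) infdist_le2[OF y, of x ?d] by (auto simp: K_def dist_commute)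
  qed
  have Kb: "K \<in> convex_bodies"
    unfolding K_def
  proof (rule convex_bodies_Int_nonempty[OF P(3)])
    show "convex {x. infdist x L \<le> ?d}"
      by (rule convex_infdist_le[OF Lc])
    show "closed {x. infdist x L \<le> ?d}"
      by (intro closed_Collect_le continuous_intros)
    show "Phat \<inter> {x. infdist x L \<le> ?d} \<noteq> {}"
      using Lc(3) near by (auto simp: K_def)
  qed
  have KL: "hausdorff_dist K L \<le> ?d"
  proof (rule hausdorff_dist_le[OF Kb L(1)])
    show "infdist x L \<le> ?d" if "x \<in> K" for x
      using that by (simp add: K_def)
    show "infdist y K \<le> ?d" if "y \<in> L" for y
      using near[OF that] infdist_le2 by blast
  qed
  obtain Q where Q: "Q \<in> Pi_flat N a K"
    using Pi_flat_nonempty[OF Kb] by blast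
  have "norm x \<le> body_norm Khat" if "x \<in> K" for x
    using R that P(2) by (auto simp: K_def)
  note Q = Pi_flat_approx[OF a N Kb Q this]
  have "hausdorff_dist Q L \<le> hausdorff_dist Q K + hausdorff_dist K L"
    by (rule convex_bodies.triangle[OF Q(3) Kb L(1)])
  then have "hausdorff_dist Q L \<le> 4 * mesh N a * body_norm Khat"
    using Q(4) KL by linarith
  moreover have "Q \<subseteq> Phat" using Q(2) by (auto simp: K_def)
  ultimately show ?thesis using Q(1) by blast
qed

text \<open>The polytope of \<open>L\<close> lies in \<open>L\<close>, hence in every container of
  \<open>L\<close>; this serves both \<open>Khat\<close> and \<open>Pi_sharp\<close>. Measuring with
  the norm of \<open>Khat\<close> makes the bound uniform in \<open>L\<close>.\<close>

lemma P_flat_approx_inside: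
  fixes a :: "nat \<Rightarrow> real ^ 'd"
  assumes a: "unit_directions N a" and N: "0 < N" and Khat: "Khat \<in> convex_bodies"
    and L: "L \<in> convex_bodies" "L \<subseteq> Khat"
  shows "\<exists>Q\<in>P_flat N a. Q \<subseteq> L \<and> hausdorff_dist Q L \<le> 2 * mesh N a * body_norm Khat"
proof -
  obtain Q where Q: "Q \<in> Pi_flat N a L"
    using Pi_flat_nonempty[OF L(1)] by blast
  have "norm x \<le> body_norm Khat" if "x \<in> L" for x
    using norm_le_body_norm[OF Khat] that L(2) by blast
  from Pi_flat_approx[OF a N L(1) Q this] show ?thesis by blast
qed

lemma subset_Pi_sharp:
  assumes "K \<in> convex_bodies"
  shows "K \<subseteq> Pi_sharp N a K"
proof -
  have "bdd_above ((\<lambda>y. a i \<bullet> y) ` K)" for i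
    using assms by (intro bounded_imp_bdd_above compact_imp_bounded compact_continuous_image continuous_intros)
      (auto simp: convex_bodies_def)
  then show ?thesis
    by (auto simp: Pi_sharp_def intro: cSUP_upper)
qed

lemma Pi_sharp_eq: "Pi_sharp N a K = (\<Inter>i\<in>{1..N}. {x. a i \<bullet> x \<le> (SUP y\<in>K. a i \<bullet> y)})"
  by (auto simp: Pi_sharp_def)

lemma convex_Pi_sharp: "convex (Pi_sharp N a K)"
  unfolding Pi_sharp_eq by (intro convex_INT convex_halfspace_le)

text \<open>Finitely many half-spaces need not bound a region; boundedness comes from the mesh being
  below 1.\<close>

lemma compact_Pi_sharp:
  assumes "unit_directions N a" "0 < N" and K: "K \<in> convex_bodies" and "mesh N a < 1"
  shows "compact (Pi_sharp N a K)"
proof -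
  let ?e = "2 * mesh N a * body_norm K / (1 - mesh N a)"
  have Kc: "closed K" "K \<noteq> {}"
    using K by (auto simp: convex_bodies_def compact_imp_closed)
  have "norm x \<le> ?e + body_norm K" if "x \<in> Pi_sharp N a K" for x
  proof -
    obtain y where y: "y \<in> K" "infdist x K = dist x y"
      using infdist_attains_inf[OF Kc] by blast
    then show ?thesis
      using Pi_sharp_bounds[OF assms that] norm_le_body_norm[OF K y(1)] norm_triangle_sub[of x y]
      by (simp add: dist_norm)
  qed
  then have "bounded (Pi_sharp N a K)"
    unfolding bounded_iff by blast
  moreover have "closed (Pi_sharp N a K)"
    unfolding Pi_sharp_eq by (intro closed_INT ballI closed_halfspace_le)
  ultimately show ?thesis
    by (simp add: compact_eq_bounded_closed)
qed

section \<open>The three instances of the scheme\<close>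

theorem theorem47:
  fixes \<Phi> :: "(real ^ 'd) set \<Rightarrow> real"
    and \<Psi> :: "(real ^ 'd) set \<Rightarrow> real ^ 'm"
    and Khat :: "(real ^ 'd) set"
    and N :: "nat \<Rightarrow> nat"
    and a :: "nat \<Rightarrow> nat \<Rightarrow> real ^ 'd"
    and Phat :: "nat \<Rightarrow> (real ^ 'd) set"
    and l :: real
    and \<Phi>_flat_flat \<Phi>_flat \<Phi>_flat_sharp :: "nat \<Rightarrow> (real ^ 'd) set \<Rightarrow> real"
  assumes "CARD('d) \<ge> 2"
    and "continuous_map hausdorff_topology euclideanreal \<Phi>"
    and "\<And>\<A>. \<A> \<subseteq> convex_bodies \<Longrightarrow> convex_bodies.mbounded \<A> \<Longrightarrow> \<exists>L. lipschitz_on_bodies L \<Psi> \<A>"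
    and "Khat \<in> convex_bodies"
    and "feasible \<Psi> Khat \<noteq> {}"
    and "nested_galerkin N a"
    and "\<And>k. Phat k \<in> Pi_flat (N k) (a k) Khat"
    and "l > 0"
    and "lipschitz_on_bodies l \<Psi>
           (feasible \<Psi> Khat \<union>
            (\<Union>k. {P \<in> P_flat (N k) (a k). P \<subseteq> Phat k} \<union>
                 {P \<in> P_flat (N k) (a k). P \<subseteq> Khat} \<union>
                 {P \<in> P_flat (N k) (a k). P \<subseteq> Pi_sharp (N k) (a k) Khat}))"
    and "\<And>k. mesh (N k) (a k) \<in> {0<..<1}"
  defines "M \<equiv> feasible \<Psi> Khat"
    and "M_ff \<equiv> \<lambda>k. M_flat_flat \<Psi> l Khat (N k) (a k) (Phat k)"
    and "M_f \<equiv> \<lambda>k. M_flat \<Psi> l Khat (N k) (a k)"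
    and "M_fs \<equiv> \<lambda>k. M_flat_sharp \<Psi> l Khat (N k) (a k)"
  shows
    "((\<forall>k. lower_semicontinuous_map hausdorff_topology (\<Phi>_flat_flat k)) \<and>
      (\<lambda>k. SUP K\<in>M_ff k. ereal \<bar>\<Phi> K - \<Phi>_flat_flat k K\<bar>) \<longlonglongrightarrow> 0 \<longrightarrow>
        argmin_on \<Phi> M \<noteq> {} \<and>
        (\<forall>k. argmin_on (\<Phi>_flat_flat k) (M_ff k) \<noteq> {}) \<and>
        (\<lambda>k. hausdorff_excess (argmin_on (\<Phi>_flat_flat k) (M_ff k)) (argmin_on \<Phi> M)) \<longlonglongrightarrow> 0)
   \<and> ((\<forall>k. lower_semicontinuous_map hausdorff_topology (\<Phi>_flat k)) \<and>
      (\<lambda>k. SUP K\<in>M_f k. ereal \<bar>\<Phi> K - \<Phi>_flat k K\<bar>) \<longlonglongrightarrow> 0 \<longrightarrow>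
        argmin_on \<Phi> M \<noteq> {} \<and>
        (\<forall>k. argmin_on (\<Phi>_flat k) (M_f k) \<noteq> {}) \<and>
        (\<lambda>k. hausdorff_excess (argmin_on (\<Phi>_flat k) (M_f k)) (argmin_on \<Phi> M)) \<longlonglongrightarrow> 0)
   \<and> ((\<forall>k. lower_semicontinuous_map hausdorff_topology (\<Phi>_flat_sharp k)) \<and>
      (\<lambda>k. SUP K\<in>M_fs k. ereal \<bar>\<Phi> K - \<Phi>_flat_sharp k K\<bar>) \<longlonglongrightarrow> 0 \<longrightarrow>
        argmin_on \<Phi> M \<noteq> {} \<and>
        (\<forall>k. argmin_on (\<Phi>_flat_sharp k) (M_fs k) \<noteq> {}) \<and>
        (\<lambda>k. hausdorff_excess (argmin_on (\<Phi>_flat_sharp k) (M_fs k)) (argmin_on \<Phi> M)) \<longlonglongrightarrow> 0)"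
proof -
  have N: "0 < N k" and a: "unit_directions (N k) (a k)" for k
    using assms(6) by (auto simp: nested_galerkin_def)
  have m: "(\<lambda>k. mesh (N k) (a k)) \<longlonglongrightarrow> 0"
    using assms(6) by (auto simp: nested_galerkin_def)
  have m01: "0 < mesh (N k) (a k)" "mesh (N k) (a k) < 1" for k
    using assms(10)[of k] by auto
  have scaled: "(\<lambda>k. C * mesh (N k) (a k) * body_norm Khat) \<longlonglongrightarrow> 0" for C
    by (intro tendsto_mult_left_zero tendsto_mult_right_zero m)
  \<comment> \<open>The denominator tends to 1, so the protrusion of the outer container vanishes
    with the mesh.\<close>
  have sharp0: "(\<lambda>k. 2 * mesh (N k) (a k) * body_norm Khat / (1 - mesh (N k) (a k))) \<longlonglongrightarrow> 0"
    using tendsto_divide[OF scaled[of 2] tendsto_diff[OF tendsto_const[of 1] m]] by simp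
  have Khat: "compact Khat" "convex Khat" "Khat \<noteq> {}"
    using assms(4) by (auto simp: convex_bodies_def)
  note Phat = Pi_flat_approx[OF a N assms(4) assms(7) norm_le_body_norm[OF assms(4)]]
  have l0: "0 \<le> l" using assms(8) by simp
  have M: "L \<in> convex_bodies" "L \<subseteq> Khat" if "L \<in> feasible \<Psi> Khat" for L
    using that by (auto simp: feasible_def)
  have lipM: "lipschitz_on_bodies l \<Psi> (feasible \<Psi> Khat \<union> {P \<in> P_flat (N k) (a k). P \<subseteq> D})"
    if "D = Phat k \<or> D = Khat \<or> D = Pi_sharp (N k) (a k) Khat" for k D
    using assms(9) that unfolding lipschitz_on_bodies_def by blast
  note conv = galerkin_argmin_convergence[OF assms(2,3,4,5) N l0]
  have ff: "argmin_on \<Phi> M \<noteq> {} \<and>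
        (\<forall>k. argmin_on (\<Phi>_flat_flat k) (M_ff k) \<noteq> {}) \<and>
        (\<lambda>k. hausdorff_excess (argmin_on (\<Phi>_flat_flat k) (M_ff k)) (argmin_on \<Phi> M)) \<longlonglongrightarrow> 0"
    if "\<forall>k. lower_semicontinuous_map hausdorff_topology (\<Phi>_flat_flat k)"
      and "(\<lambda>k. SUP K\<in>M_ff k. ereal \<bar>\<Phi> K - \<Phi>_flat_flat k K\<bar>) \<longlonglongrightarrow> 0"
    unfolding M_def M_ff_def M_flat_flat_def Psi_flat_flat_def
  \<comment> \<open>Polytopes spanned by points of \<open>Khat\<close> do not protrude, hence
    \<open>e = 0\<close>; multiplying \<open>b\<close> by \<open>l\<close> gives the slack of
    \<open>Psi_flat_flat\<close>.\<close>
  proof (rule conv[where D = Phat and e = "\<lambda>k. 0" and b = "\<lambda>k. 4 * mesh (N k) (a k) * body_norm Khat"])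
    show "compact (Phat k)" "convex (Phat k)" for k
      using Phat(3)[of k] by (auto simp: convex_bodies_def)
    show "infdist x Khat \<le> 0" if "x \<in> Phat k" for k x
      using Phat(2)[of k] that by auto
    show "\<exists>Q\<in>P_flat (N k) (a k). Q \<subseteq> Phat k \<and> hausdorff_dist Q L \<le> 4 * mesh (N k) (a k) * body_norm Khat"
      if "L \<in> feasible \<Psi> Khat" for k L
      by (rule Pi_flat_approx_in_Pi_flat[OF a N assms(4) assms(7) M[OF that]])
  qed (use that in \<open>simp_all add: lipM scaled M_ff_def M_flat_flat_def Psi_flat_flat_def\<close>)
  have f: "argmin_on \<Phi> M \<noteq> {} \<and>
        (\<forall>k. argmin_on (\<Phi>_flat k) (M_f k) \<noteq> {}) \<and>
        (\<lambda>k. hausdorff_excess (argmin_on (\<Phi>_flat k) (M_f k)) (argmin_on \<Phi> M)) \<longlonglongrightarrow> 0"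
    if "\<forall>k. lower_semicontinuous_map hausdorff_topology (\<Phi>_flat k)"
      and "(\<lambda>k. SUP K\<in>M_f k. ereal \<bar>\<Phi> K - \<Phi>_flat k K\<bar>) \<longlonglongrightarrow> 0"
    unfolding M_def M_f_def M_flat_def Psi_flat_def
  proof (rule conv[where D = "\<lambda>k. Khat" and e = "\<lambda>k. 0" and b = "\<lambda>k. 2 * mesh (N k) (a k) * body_norm Khat"])
    show "\<exists>Q\<in>P_flat (N k) (a k). Q \<subseteq> Khat \<and> hausdorff_dist Q L \<le> 2 * mesh (N k) (a k) * body_norm Khat"
      if "L \<in> feasible \<Psi> Khat" for k L
      using P_flat_approx_inside[OF a N assms(4) M[OF that], of k] M(2)[OF that] by blast
  qed (use that in \<open>simp_all add: lipM scaled Khat M_f_def M_flat_def Psi_flat_def\<close>)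
  have fs: "argmin_on \<Phi> M \<noteq> {} \<and>
        (\<forall>k. argmin_on (\<Phi>_flat_sharp k) (M_fs k) \<noteq> {}) \<and>
        (\<lambda>k. hausdorff_excess (argmin_on (\<Phi>_flat_sharp k) (M_fs k)) (argmin_on \<Phi> M)) \<longlonglongrightarrow> 0"
    if "\<forall>k. lower_semicontinuous_map hausdorff_topology (\<Phi>_flat_sharp k)"
      and "(\<lambda>k. SUP K\<in>M_fs k. ereal \<bar>\<Phi> K - \<Phi>_flat_sharp k K\<bar>) \<longlonglongrightarrow> 0"
    unfolding M_def M_fs_def M_flat_sharp_def Psi_flat_sharp_def
  \<comment> \<open>Only here is \<open>e\<close> nonzero. It affects feasibility of limits, but not
    \<open>b\<close>, since the competitors lie in \<open>Khat\<close>.\<close>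
  proof (rule conv[where D = "\<lambda>k. Pi_sharp (N k) (a k) Khat"
          and e = "\<lambda>k. 2 * mesh (N k) (a k) * body_norm Khat / (1 - mesh (N k) (a k))"
          and b = "\<lambda>k. 2 * mesh (N k) (a k) * body_norm Khat"])
    show "compact (Pi_sharp (N k) (a k) Khat)" for k
      by (rule compact_Pi_sharp[OF a N assms(4) m01(2)])
    show "infdist x Khat \<le> 2 * mesh (N k) (a k) * body_norm Khat / (1 - mesh (N k) (a k))"
      if "x \<in> Pi_sharp (N k) (a k) Khat" for k x
      by (rule Pi_sharp_bounds[OF a N assms(4) m01(2) that])
    show "\<exists>Q\<in>P_flat (N k) (a k). Q \<subseteq> Pi_sharp (N k) (a k) Khat \<and>
        hausdorff_dist Q L \<le> 2 * mesh (N k) (a k) * body_norm Khat"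
      if "L \<in> feasible \<Psi> Khat" for k L
      using P_flat_approx_inside[OF a N assms(4) M[OF that], of k] M(2)[OF that]
        subset_Pi_sharp[OF assms(4), of "N k" "a k"] by blast
  qed (use that in \<open>simp_all add: lipM scaled sharp0 convex_Pi_sharp M_fs_def M_flat_sharp_def Psi_flat_sharp_def\<close>)
  show ?thesis
    using ff f fs by blast
qed

end
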